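(* Let $\mathcal{T}',\mathcal{T},\mathcal{T}''$ be triangulated categories which form a recollement with triangle functors $i\colon\mathcal{T}'\to\mathcal{T}$, $i_\lambda,i_\rho\colon\mathcal{T}\to\mathcal{T}'$, $j\colon\mathcal{T}\to\mathcal{T}''$, $j_\lambda,j_\rho\colon\mathcal{T}''\to\mathcal{T}$. Then there is an epivalence $$\Phi\colon \mathcal{T}\longrightarrow (i_\rho j_\lambda\downarrow\mathcal{T}')$$ from $\mathcal{T}$ to the comma category of the functor $i_\rho j_\lambda\colon\mathcal{T}''\to\mathcal{T}'$.
   Context: A recollement consists of triangulated categories $\mathcal{T}',\mathcal{T},\mathcal{T}''$ and triangle functors $i\colon\mathcal{T}'\to\mathcal{T}$, $i_\lambda,i_\rho\colon\mathcal{T}\to\mathcal{T}'$, $j\colon\mathcal{T}\to\mathcal{T}''$, $j_\lambda,j_\rho\colon\mathcal{T}''\to\mathcal{T}$ such that: (1) $(i_\lambda,i)$, $(i,i_\rho)$, $(j_\lambda,j)$, $(j,j_\rho)$ are adjoint pairs (left adjoint written first); (2) $i,j_\lambda,j_\rho$ are fully faithful; (3) $ji\simeq 0$; (4) for each $X\in\mathcal{T}$ there are exact triangles $ii_\rho(X)\xrightarrow{\varepsilon_X}X\xrightarrow{\eta_X}j_\rho j(X)\xrightarrow{\delta_X}\Sigma ii_\rho(X)$ and $j_\lambda j(X)\xrightarrow{\phi_X}X\xrightarrow{\psi_X}ii_\lambda(X)\xrightarrow{\sigma_X}\Sigma j_\lambda j(X)$, where $\varepsilon,\phi$ are the counits of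 $(i,i_\rho)$, $(j_\lambda,j)$ and $\eta,\psi$ are the units of $(j,j_\rho)$, $(i_\lambda,i)$. For a functor $F\colon\mathcal{C}\to\mathcal{D}$, the comma category $(F\downarrow\mathcal{D})$ has as objects the triples $(C,D;f)$ with $C\in\mathcal{C}$, $D\in\mathcal{D}$ and $f\colon F(C)\to D$ a morphism in $\mathcal{D}$; morphisms $(C,D;f)\to(C',D';f')$ are pairs $(a,b)$ with $a\colon C\to C'$, $b\colon D\to D'$ and $f'\circ F(a)=b\circ f$. A functor is an epivalence if it is full, dense (essentially surjective on objects), and detects isomorphisms between objects (a morphism is an isomorphism whenever its image is). *)

theory Defs
  imports "HOL-Algebra.Group"
begin

section \<open>Categories, functors, natural transformations\<close>

record ('o, 'm) cat =
  Ob :: "'o set"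
  Arr :: "'m set"
  Dom :: "'m \<Rightarrow> 'o"
  Cod :: "'m \<Rightarrow> 'o"
  Id :: "'o \<Rightarrow> 'm"
  Comp :: "'m \<Rightarrow> 'm \<Rightarrow> 'm"  (infixl "\<cdot>\<index>" 70)

definition Hom :: "('o, 'm, 'x) cat_scheme \<Rightarrow> 'o \<Rightarrow> 'o \<Rightarrow> 'm set" where
  "Hom C A B = {f \<in> Arr C. Dom C f = A \<and> Cod C f = B}"

locale category =
  fixes C :: "('o, 'm, 'x) cat_scheme" (structure)
  assumes Dom_Ob: "f \<in> Arr C \<Longrightarrow> Dom C f \<in> Ob C"
    and Cod_Ob: "f \<in> Arr C \<Longrightarrow> Cod C f \<in> Ob C"
    and Id_Hom: "A \<in> Ob C \<Longrightarrow> Id C A \<in> Hom C A A"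
    and Comp_Hom: "\<lbrakk>f \<in> Hom C A B; g \<in> Hom C B D\<rbrakk> \<Longrightarrow> g \<cdot> f \<in> Hom C A D"
    and Comp_Id: "f \<in> Hom C A B \<Longrightarrow> f \<cdot> Id C A = f"
    and Id_Comp: "f \<in> Hom C A B \<Longrightarrow> Id C B \<cdot> f = f"
    and Comp_assoc: "\<lbrakk>f \<in> Hom C A B; g \<in> Hom C B D; h \<in> Hom C D E\<rbrakk>
      \<Longrightarrow> h \<cdot> (g \<cdot> f) = (h \<cdot> g) \<cdot> f"

definition isomorphism :: "('o, 'm, 'x) cat_scheme \<Rightarrow> 'm \<Rightarrow> bool" where
  "isomorphism C f \<longleftrightarrow> f \<in> Arr C \<and>
    (\<exists>g \<in> Hom C (Cod C f) (Dom C f).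
      g \<cdot>\<^bsub>C\<^esub> f = Id C (Dom C f) \<and> f \<cdot>\<^bsub>C\<^esub> g = Id C (Cod C f))"

definition isomorphic :: "('o, 'm, 'x) cat_scheme \<Rightarrow> 'o \<Rightarrow> 'o \<Rightarrow> bool" where
  "isomorphic C A B \<longleftrightarrow> (\<exists>f \<in> Hom C A B. isomorphism C f)"

definition zero_object :: "('o, 'm, 'x) cat_scheme \<Rightarrow> 'o \<Rightarrow> bool" where
  "zero_object C Z \<longleftrightarrow> Z \<in> Ob C \<and>
    (\<forall>A \<in> Ob C. (\<exists>!f. f \<in> Hom C A Z) \<and> (\<exists>!f. f \<in> Hom C Z A))"

record ('o, 'm, 'p, 'n) func =
  on_Ob :: "'o \<Rightarrow> 'p"
  on_Arr :: "'m \<Rightarrow> 'n"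

locale is_functor = source: category C + target: category D
  for C :: "('o, 'm, 'x) cat_scheme" and D :: "('p, 'n, 'y) cat_scheme" +
  fixes F :: "('o, 'm, 'p, 'n) func"
  assumes on_Ob_Ob: "A \<in> Ob C \<Longrightarrow> on_Ob F A \<in> Ob D"
    and on_Arr_Hom: "f \<in> Hom C A B \<Longrightarrow> on_Arr F f \<in> Hom D (on_Ob F A) (on_Ob F B)"
    and on_Arr_Id: "A \<in> Ob C \<Longrightarrow> on_Arr F (Id C A) = Id D (on_Ob F A)"
    and on_Arr_Comp: "\<lbrakk>f \<in> Hom C A B; g \<in> Hom C B E\<rbrakk>
      \<Longrightarrow> on_Arr F (g \<cdot>\<^bsub>C\<^esub> f) = on_Arr F g \<cdot>\<^bsub>D\<^esub> on_Arr F f"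

definition id_functor :: "('o, 'm, 'o, 'm) func" where
  "id_functor = \<lparr>on_Ob = (\<lambda>A. A), on_Arr = (\<lambda>f. f)\<rparr>"

definition comp_functor ::
  "('p, 'n, 'q, 'l) func \<Rightarrow> ('o, 'm, 'p, 'n) func \<Rightarrow> ('o, 'm, 'q, 'l) func"
  (infixr "\<circ>\<^sub>F" 75) where
  "G \<circ>\<^sub>F F = \<lparr>on_Ob = (\<lambda>A. on_Ob G (on_Ob F A)), on_Arr = (\<lambda>f. on_Arr G (on_Arr F f))\<rparr>"

definition constant_functor :: "('p, 'n, 'y) cat_scheme \<Rightarrow> 'p \<Rightarrow> ('o, 'm, 'p, 'n) func" where
  "constant_functor D Z = \<lparr>on_Ob = (\<lambda>_. Z), on_Arr = (\<lambda>_. Id D Z)\<rparr>"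

locale natural_transformation = F: is_functor C D F + G: is_functor C D G
  for C :: "('o, 'm, 'x) cat_scheme" and D :: "('p, 'n, 'y) cat_scheme"
    and F :: "('o, 'm, 'p, 'n) func" and G :: "('o, 'm, 'p, 'n) func" +
  fixes \<tau> :: "'o \<Rightarrow> 'n"
  assumes component: "A \<in> Ob C \<Longrightarrow> \<tau> A \<in> Hom D (on_Ob F A) (on_Ob G A)"
    and natural: "f \<in> Hom C A B \<Longrightarrow> \<tau> B \<cdot>\<^bsub>D\<^esub> on_Arr F f = on_Arr G f \<cdot>\<^bsub>D\<^esub> \<tau> A"

locale natural_isomorphism = natural_transformation +
  assumes component_iso: "A \<in> Ob C \<Longrightarrow> isomorphism D (\<tau> A)"

definition naturally_isomorphic ::
  "('o, 'm, 'x) cat_scheme \<Rightarrow> ('p, 'n, 'y) cat_scheme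
    \<Rightarrow> ('o, 'm, 'p, 'n) func \<Rightarrow> ('o, 'm, 'p, 'n) func \<Rightarrow> bool" where
  "naturally_isomorphic C D F G \<longleftrightarrow> (\<exists>\<tau>. natural_isomorphism C D F G \<tau>)"

definition equivalence_functor ::
  "('o, 'm, 'x) cat_scheme \<Rightarrow> ('p, 'n, 'y) cat_scheme \<Rightarrow> ('o, 'm, 'p, 'n) func \<Rightarrow> bool" where
  "equivalence_functor C D F \<longleftrightarrow> is_functor C D F \<and>
    (\<exists>G. is_functor D C G \<and>
      naturally_isomorphic C C (G \<circ>\<^sub>F F) id_functor \<and>
      naturally_isomorphic D D (F \<circ>\<^sub>F G) id_functor)"

text \<open>\<open>L : C \<rightarrow> D\<close> is left adjoint to \<open>R : D \<rightarrow> C\<close>.\<close>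

locale adjunction =
  left: is_functor C D L + right: is_functor D C R +
  unit: natural_transformation C C id_functor "R \<circ>\<^sub>F L" \<eta> +
  counit: natural_transformation D D "L \<circ>\<^sub>F R" id_functor \<epsilon>
  for C :: "('o, 'm, 'x) cat_scheme" and D :: "('p, 'n, 'y) cat_scheme"
    and L :: "('o, 'm, 'p, 'n) func" and R :: "('p, 'n, 'o, 'm) func"
    and \<eta> :: "'o \<Rightarrow> 'm" and \<epsilon> :: "'p \<Rightarrow> 'n" +
  assumes triangle_left: "A \<in> Ob C \<Longrightarrow>
      \<epsilon> (on_Ob L A) \<cdot>\<^bsub>D\<^esub> on_Arr L (\<eta> A) = Id D (on_Ob L A)"
    and triangle_right: "B \<in> Ob D \<Longrightarrow>
      on_Arr R (\<epsilon> B) \<cdot>\<^bsub>C\<^esub> \<eta> (on_Ob R B) = Id C (on_Ob R B)"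

definition full ::
  "('o, 'm, 'x) cat_scheme \<Rightarrow> ('p, 'n, 'y) cat_scheme \<Rightarrow> ('o, 'm, 'p, 'n) func \<Rightarrow> bool" where
  "full C D F \<longleftrightarrow> (\<forall>A \<in> Ob C. \<forall>B \<in> Ob C. \<forall>g \<in> Hom D (on_Ob F A) (on_Ob F B).
    \<exists>f \<in> Hom C A B. on_Arr F f = g)"

definition faithful ::
  "('o, 'm, 'x) cat_scheme \<Rightarrow> ('o, 'm, 'p, 'n) func \<Rightarrow> bool" where
  "faithful C F \<longleftrightarrow> (\<forall>A \<in> Ob C. \<forall>B \<in> Ob C. inj_on (on_Arr F) (Hom C A B))"

definition fully_faithful ::
  "('o, 'm, 'x) cat_scheme \<Rightarrow> ('p, 'n, 'y) cat_scheme \<Rightarrow> ('o, 'm, 'p, 'n) func \<Rightarrow> bool" where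
  "fully_faithful C D F \<longleftrightarrow> full C D F \<and> faithful C F"

definition dense ::
  "('o, 'm, 'x) cat_scheme \<Rightarrow> ('p, 'n, 'y) cat_scheme \<Rightarrow> ('o, 'm, 'p, 'n) func \<Rightarrow> bool" where
  "dense C D F \<longleftrightarrow> (\<forall>B \<in> Ob D. \<exists>A \<in> Ob C. isomorphic D (on_Ob F A) B)"

definition detects_isomorphisms ::
  "('o, 'm, 'x) cat_scheme \<Rightarrow> ('p, 'n, 'y) cat_scheme \<Rightarrow> ('o, 'm, 'p, 'n) func \<Rightarrow> bool" where
  "detects_isomorphisms C D F \<longleftrightarrow>
    (\<forall>f \<in> Arr C. isomorphism D (on_Arr F f) \<longrightarrow> isomorphism C f)"

definition epivalence ::
  "('o, 'm, 'x) cat_scheme \<Rightarrow> ('p, 'n, 'y) cat_scheme \<Rightarrow> ('o, 'm, 'p, 'n) func \<Rightarrow> bool" where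
  "epivalence C D F \<longleftrightarrow>
    is_functor C D F \<and> full C D F \<and> dense C D F \<and> detects_isomorphisms C D F"

section \<open>Comma categories\<close>

text \<open>
  The category \<open>(F \<down> D)\<close> of a functor \<open>F : C \<rightarrow> D\<close>. Since every arrow of a \<open>cat\<close>
  determines its domain and codomain, a morphism \<open>(a, b)\<close> is stored together with its
  source and target objects.
\<close>

type_synonym ('o, 'p, 'n) comma_ob = "'o \<times> 'p \<times> 'n"
type_synonym ('o, 'm, 'p, 'n) comma_arr =
  "('o, 'p, 'n) comma_ob \<times> ('o, 'p, 'n) comma_ob \<times> 'm \<times> 'n"

definition comma ::
  "('o, 'm, 'x) cat_scheme \<Rightarrow> ('p, 'n, 'y) cat_scheme \<Rightarrow> ('o, 'm, 'p, 'n) func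
    \<Rightarrow> (('o, 'p, 'n) comma_ob, ('o, 'm, 'p, 'n) comma_arr) cat" where
  "comma C D F =
    (let obs = {(A, B, f). A \<in> Ob C \<and> B \<in> Ob D \<and> f \<in> Hom D (on_Ob F A) B} in
    \<lparr>Ob = obs,
     Arr = {((A, B, f), (A', B', f'), a, b) | A B f A' B' f' a b.
       (A, B, f) \<in> obs \<and> (A', B', f') \<in> obs \<and> a \<in> Hom C A A' \<and> b \<in> Hom D B B' \<and>
       f' \<cdot>\<^bsub>D\<^esub> on_Arr F a = b \<cdot>\<^bsub>D\<^esub> f},
     Dom = (\<lambda>(X, Y, a, b). X),
     Cod = (\<lambda>(X, Y, a, b). Y),
     Id = (\<lambda>(A, B, f). ((A, B, f), (A, B, f), Id C A, Id D B)),
     Comp = (\<lambda>(Y', Z, a', b') (X, Y, a, b). (X, Z, a' \<cdot>\<^bsub>C\<^esub> a, b' \<cdot>\<^bsub>D\<^esub> b))\<rparr>)"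

section \<open>Additive categories\<close>

record ('o, 'm) add_cat = "('o, 'm) cat" +
  Plus :: "'m \<Rightarrow> 'm \<Rightarrow> 'm"  (infixl "\<oplus>\<index>" 65)
  Zero :: "'o \<Rightarrow> 'o \<Rightarrow> 'm"

definition hom_group :: "('o, 'm, 'x) add_cat_scheme \<Rightarrow> 'o \<Rightarrow> 'o \<Rightarrow> 'm monoid" where
  "hom_group C A B = \<lparr>carrier = Hom C A B, mult = Plus C, one = Zero C A B\<rparr>"

definition Minus :: "('o, 'm, 'x) add_cat_scheme \<Rightarrow> 'm \<Rightarrow> 'm" where
  "Minus C f = inv\<^bsub>hom_group C (Dom C f) (Cod C f)\<^esub> f"

locale additive_category = category C
  for C :: "('o, 'm, 'x) add_cat_scheme" (structure) +
  assumes hom_comm_group: "\<lbrakk>A \<in> Ob C; B \<in> Ob C\<rbrakk> \<Longrightarrow> comm_group (hom_group C A B)"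
    and Comp_Plus: "\<lbrakk>f \<in> Hom C A B; f' \<in> Hom C A B; g \<in> Hom C B D\<rbrakk>
      \<Longrightarrow> g \<cdot> (f \<oplus> f') = g \<cdot> f \<oplus> g \<cdot> f'"
    and Plus_Comp: "\<lbrakk>f \<in> Hom C A B; g \<in> Hom C B D; g' \<in> Hom C B D\<rbrakk>
      \<Longrightarrow> (g \<oplus> g') \<cdot> f = g \<cdot> f \<oplus> g' \<cdot> f"
    and ex_zero_object: "\<exists>Z. zero_object C Z"
    and ex_biproduct: "\<lbrakk>A \<in> Ob C; B \<in> Ob C\<rbrakk> \<Longrightarrow>
      \<exists>P \<in> Ob C. \<exists>p \<in> Hom C P A. \<exists>q \<in> Hom C P B. \<exists>u \<in> Hom C A P. \<exists>v \<in> Hom C B P.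
        p \<cdot> u = Id C A \<and> q \<cdot> v = Id C B \<and> p \<cdot> v = Zero C B A \<and> q \<cdot> u = Zero C A B \<and>
        u \<cdot> p \<oplus> v \<cdot> q = Id C P"

locale additive_functor = is_functor C D F +
  source: additive_category C + target: additive_category D
  for C :: "('o, 'm, 'x) add_cat_scheme" and D :: "('p, 'n, 'y) add_cat_scheme"
    and F :: "('o, 'm, 'p, 'n) func" +
  assumes on_Arr_Plus: "\<lbrakk>f \<in> Hom C A B; g \<in> Hom C A B\<rbrakk>
    \<Longrightarrow> on_Arr F (f \<oplus>\<^bsub>C\<^esub> g) = on_Arr F f \<oplus>\<^bsub>D\<^esub> on_Arr F g"

section \<open>Triangulated categories\<close>

text \<open>
  \<open>Exact\<close> is the class of exact triangles; a triangle
  \<open>X \<rightarrow> Y \<rightarrow> Z \<rightarrow> \<Sigma>X\<close> is encoded by its three arrows.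
\<close>

record ('o, 'm) tri_cat = "('o, 'm) add_cat" +
  Susp :: "('o, 'm, 'o, 'm) func"
  Exact :: "('m \<times> 'm \<times> 'm) set"

definition triangle ::
  "('o, 'm, 'x) tri_cat_scheme \<Rightarrow> 'o \<Rightarrow> 'o \<Rightarrow> 'o \<Rightarrow> 'm \<Rightarrow> 'm \<Rightarrow> 'm \<Rightarrow> bool" where
  "triangle T X Y Z f g h \<longleftrightarrow> f \<in> Hom T X Y \<and> g \<in> Hom T Y Z \<and> h \<in> Hom T Z (on_Ob (Susp T) X)"

definition exact_triangle ::
  "('o, 'm, 'x) tri_cat_scheme \<Rightarrow> 'o \<Rightarrow> 'o \<Rightarrow> 'o \<Rightarrow> 'm \<Rightarrow> 'm \<Rightarrow> 'm \<Rightarrow> bool" where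
  "exact_triangle T X Y Z f g h \<longleftrightarrow> triangle T X Y Z f g h \<and> (f, g, h) \<in> Exact T"

locale triangulated_category = additive_category T
  for T :: "('o, 'm, 'x) tri_cat_scheme" (structure) +
  assumes Susp_additive: "additive_functor T T (Susp T)"
    and Susp_equivalence: "equivalence_functor T T (Susp T)"
    and Exact_triangle: "(f, g, h) \<in> Exact T \<Longrightarrow> \<exists>X Y Z. triangle T X Y Z f g h"
    and TR1_iso: "\<lbrakk>exact_triangle T X Y Z f g h; triangle T X' Y' Z' f' g' h';
        a \<in> Hom T X X'; b \<in> Hom T Y Y'; c \<in> Hom T Z Z';
        isomorphism T a; isomorphism T b; isomorphism T c;
        b \<cdot> f = f' \<cdot> a; c \<cdot> g = g' \<cdot> b; on_Arr (Susp T) a \<cdot> h = h' \<cdot> c\<rbrakk>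
      \<Longrightarrow> exact_triangle T X' Y' Z' f' g' h'"
    and TR1_Id: "\<lbrakk>X \<in> Ob T; zero_object T Z\<rbrakk>
      \<Longrightarrow> exact_triangle T X X Z (Id T X) (Zero T X Z) (Zero T Z (on_Ob (Susp T) X))"
    and TR1_ex: "f \<in> Hom T X Y \<Longrightarrow> \<exists>Z g h. exact_triangle T X Y Z f g h"
    and TR2: "triangle T X Y Z f g h \<Longrightarrow>
      exact_triangle T X Y Z f g h \<longleftrightarrow>
      exact_triangle T Y Z (on_Ob (Susp T) X) g h (Minus T (on_Arr (Susp T) f))"
    and TR3: "\<lbrakk>exact_triangle T X Y Z f g h; exact_triangle T X' Y' Z' f' g' h';
        a \<in> Hom T X X'; b \<in> Hom T Y Y'; b \<cdot> f = f' \<cdot> a\<rbrakk>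
      \<Longrightarrow> \<exists>c \<in> Hom T Z Z'. c \<cdot> g = g' \<cdot> b \<and> on_Arr (Susp T) a \<cdot> h = h' \<cdot> c"
    and TR4: "\<lbrakk>exact_triangle T X Y U f1 f2 f3; exact_triangle T Y Z W g1 g2 g3;
        exact_triangle T X Z V (g1 \<cdot> f1) h2 h3\<rbrakk>
      \<Longrightarrow> \<exists>k1 k2 k3. exact_triangle T U V W k1 k2 k3 \<and>
        k1 \<cdot> f2 = h2 \<cdot> g1 \<and> h3 \<cdot> k1 = f3 \<and> k2 \<cdot> h2 = g2 \<and>
        g3 \<cdot> k2 = on_Arr (Susp T) f1 \<cdot> h3 \<and> k3 = on_Arr (Susp T) f2 \<cdot> g3"

definition triangle_functor ::
  "('o, 'm, 'x) tri_cat_scheme \<Rightarrow> ('p, 'n, 'y) tri_cat_scheme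
    \<Rightarrow> ('o, 'm, 'p, 'n) func \<Rightarrow> bool" where
  "triangle_functor S T F \<longleftrightarrow> additive_functor S T F \<and>
    (\<exists>\<theta>. natural_isomorphism S T (F \<circ>\<^sub>F Susp S) (Susp T \<circ>\<^sub>F F) \<theta> \<and>
      (\<forall>X Y Z f g h. exact_triangle S X Y Z f g h \<longrightarrow>
        exact_triangle T (on_Ob F X) (on_Ob F Y) (on_Ob F Z)
          (on_Arr F f) (on_Arr F g) (\<theta> X \<cdot>\<^bsub>T\<^esub> on_Arr F h)))"

section \<open>Recollements\<close>

text \<open>
  The subscripts \<open>l\<close> and \<open>r\<close> mark the left adjoints \<open>i\<^sub>\<lambda>, j\<^sub>\<lambda>\<close> and the right adjoints
  \<open>i\<^sub>\<rho>, j\<^sub>\<rho>\<close>. The units and counits of the four adjunctions are not required to commute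
  with the suspensions; the triangles in the last clause use those same units and counits.
\<close>

definition recollement ::
  "('o1, 'm1, 'x1) tri_cat_scheme \<Rightarrow> ('o, 'm, 'x) tri_cat_scheme \<Rightarrow> ('o2, 'm2, 'x2) tri_cat_scheme
    \<Rightarrow> ('o1, 'm1, 'o, 'm) func \<Rightarrow> ('o, 'm, 'o1, 'm1) func \<Rightarrow> ('o, 'm, 'o1, 'm1) func
    \<Rightarrow> ('o, 'm, 'o2, 'm2) func \<Rightarrow> ('o2, 'm2, 'o, 'm) func \<Rightarrow> ('o2, 'm2, 'o, 'm) func
    \<Rightarrow> bool" where
  "recollement T' T T'' i i\<^sub>l i\<^sub>r j j\<^sub>l j\<^sub>r \<longleftrightarrow>
    triangulated_category T' \<and> triangulated_category T \<and> triangulated_category T'' \<and>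
    triangle_functor T' T i \<and> triangle_functor T T' i\<^sub>l \<and> triangle_functor T T' i\<^sub>r \<and>
    triangle_functor T T'' j \<and> triangle_functor T'' T j\<^sub>l \<and> triangle_functor T'' T j\<^sub>r \<and>
    fully_faithful T' T i \<and> fully_faithful T'' T j\<^sub>l \<and> fully_faithful T'' T j\<^sub>r \<and>
    (\<exists>Z. zero_object T'' Z \<and> naturally_isomorphic T' T'' (j \<circ>\<^sub>F i) (constant_functor T'' Z)) \<and>
    (\<exists>\<psi> \<psi>' \<epsilon>' \<epsilon> \<phi>' \<phi> \<eta> \<eta>'.
      adjunction T T' i\<^sub>l i \<psi> \<psi>' \<and> adjunction T' T i i\<^sub>r \<epsilon>' \<epsilon> \<and>
      adjunction T'' T j\<^sub>l j \<phi>' \<phi> \<and> adjunction T T'' j j\<^sub>r \<eta> \<eta>' \<and>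
      (\<forall>X \<in> Ob T.
        (\<exists>\<delta>. exact_triangle T (on_Ob (i \<circ>\<^sub>F i\<^sub>r) X) X (on_Ob (j\<^sub>r \<circ>\<^sub>F j) X) (\<epsilon> X) (\<eta> X) \<delta>) \<and>
        (\<exists>\<sigma>. exact_triangle T (on_Ob (j\<^sub>l \<circ>\<^sub>F j) X) X (on_Ob (i \<circ>\<^sub>F i\<^sub>l) X) (\<phi> X) (\<psi> X) \<sigma>)))"

end

theory Submission
  imports Defs
begin

text \<open>
  Take \<open>\<Phi> X = (j X, i\<^sub>\<rho> X; i\<^sub>\<rho> \<phi>\<^sub>X)\<close>. By adjunction, a morphism \<open>(a, b) : \<Phi> X \<rightarrow> \<Phi> Y\<close> amounts to
  maps \<open>j\<^sub>\<lambda> j X \<rightarrow> Y\<close> and \<open>i i\<^sub>\<rho> X \<rightarrow> Y\<close> that agree on \<open>i i\<^sub>\<rho> j\<^sub>\<lambda> j X\<close>. The map \<open>\<phi>\<^sub>X\<close> induces a morphism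
  between the triangles \<open>i i\<^sub>\<rho> \<rightarrow> 1 \<rightarrow> j\<^sub>\<rho> j \<rightarrow>\<close> of \<open>j\<^sub>\<lambda> j X\<close> and \<open>X\<close> which is invertible on the third
  terms, so the square on its first two terms is a weak pushout and \<open>(a, b)\<close> lifts: \<open>\<Phi>\<close> is full.
  If \<open>\<Phi> e\<close> is an identity, then \<open>e - 1\<close> factors through \<open>\<eta>\<close> and is killed by \<open>\<eta>\<close>, hence squares
  to zero and \<open>e\<close> is invertible; together with fullness, \<open>\<Phi>\<close> detects isomorphisms. An object
  \<open>(A, B; f)\<close> is hit, up to isomorphism, by the homotopy pushout of \<open>i i\<^sub>\<rho> j\<^sub>\<lambda> A \<rightarrow> j\<^sub>\<lambda> A\<close> along \<open>i f\<close>.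
\<close>

section \<open>Categories, functors and adjunctions\<close>

context category
begin

lemma Hom_Ob: "f \<in> Hom C A B \<Longrightarrow> A \<in> Ob C" "f \<in> Hom C A B \<Longrightarrow> B \<in> Ob C"
  using Dom_Ob Cod_Ob by (auto simp: Hom_def)

text \<open>Phrased with \<open>Arr\<close>, \<open>Dom\<close> and \<open>Cod\<close> so that no
  intermediate object has to be guessed: once \<open>Hom_def\<close> is unfolded, the simplifier can
  check composability by itself.\<close>

lemma Comp_arr [simp]:
  assumes "f \<in> Arr C" "g \<in> Arr C" "Dom C g = Cod C f"
  shows "g \<cdot> f \<in> Arr C" "Dom C (g \<cdot> f) = Dom C f" "Cod C (g \<cdot> f) = Cod C g"
  using Comp_Hom[of f "Dom C f" "Cod C f" g "Cod C g"] assms by (auto simp: Hom_def)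

lemma Id_arr [simp]:
  assumes "A \<in> Ob C"
  shows "Id C A \<in> Arr C" "Dom C (Id C A) = A" "Cod C (Id C A) = A"
  using Id_Hom[OF assms] by (auto simp: Hom_def)

lemma Comp_Id_arr [simp]: "f \<in> Arr C \<Longrightarrow> Dom C f = A \<Longrightarrow> f \<cdot> Id C A = f"
  using Comp_Id[of f A "Cod C f"] by (auto simp: Hom_def)

lemma Id_Comp_arr [simp]: "f \<in> Arr C \<Longrightarrow> Cod C f = B \<Longrightarrow> Id C B \<cdot> f = f"
  using Id_Comp[of f "Dom C f" B] by (auto simp: Hom_def)

lemma Comp_assoc_arr [simp]:
  "\<lbrakk>f \<in> Arr C; g \<in> Arr C; h \<in> Arr C; Dom C g = Cod C f; Dom C h = Cod C g\<rbrakk>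
    \<Longrightarrow> (h \<cdot> g) \<cdot> f = h \<cdot> (g \<cdot> f)"
  by (rule Comp_assoc[of f "Dom C f" "Cod C f" g "Cod C g" h "Cod C h", symmetric])
    (simp_all add: Hom_def)

lemma isomorphismI:
  assumes "f \<in> Hom C A B" "g \<in> Hom C B A" "g \<cdot> f = Id C A" "f \<cdot> g = Id C B"
  shows "isomorphism C f"
  using assms unfolding isomorphism_def by (auto simp: Hom_def)

lemma isomorphismE:
  assumes "isomorphism C f" "f \<in> Hom C A B"
  obtains g where "g \<in> Hom C B A" "g \<cdot> f = Id C A" "f \<cdot> g = Id C B"
  using assms unfolding isomorphism_def by (auto simp: Hom_def)

text \<open>The two one-sided inverses coincide: \<open>g = g (f h) = (g f) h = h\<close>.\<close>

lemma isomorphism_left_right_inverse: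
  assumes f: "f \<in> Hom C A B" and g: "g \<in> Hom C B A" and h: "h \<in> Hom C B A"
    and gf: "g \<cdot> f = Id C A" and fh: "f \<cdot> h = Id C B"
  shows "isomorphism C f"
proof -
  have "g = (g \<cdot> f) \<cdot> h"
    using Comp_assoc[OF h f g] fh Comp_Id[OF g] by metis
  then have "g = h" using gf Id_Comp[OF h] by metis
  then show ?thesis using isomorphismI[OF f g gf] fh by blast
qed

lemma isomorphism_cancel_left:
  assumes iso: "isomorphism C g" and g: "g \<in> Hom C B D" and x: "x \<in> Hom C A B"
    and y: "y \<in> Hom C A B" and eq: "g \<cdot> x = g \<cdot> y"
  shows "x = y"
proof -
  obtain k where k: "k \<in> Hom C D B" "k \<cdot> g = Id C B"
    using isomorphismE[OF iso g] by metis
  show ?thesis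
    using Comp_assoc[OF x g k(1)] Comp_assoc[OF y g k(1)] eq k(2) Id_Comp[OF x] Id_Comp[OF y] by metis
qed

lemma isomorphism_cancel_right:
  assumes iso: "isomorphism C g" and g: "g \<in> Hom C A B" and x: "x \<in> Hom C B D"
    and y: "y \<in> Hom C B D" and eq: "x \<cdot> g = y \<cdot> g"
  shows "x = y"
proof -
  obtain k where k: "k \<in> Hom C B A" "g \<cdot> k = Id C B"
    using isomorphismE[OF iso g] by metis
  show ?thesis
    using Comp_assoc[OF k(1) g x] Comp_assoc[OF k(1) g y] eq k(2) Comp_Id[OF x] Comp_Id[OF y] by metis
qed

lemma isomorphism_Comp:
  assumes f: "f \<in> Hom C A B" "isomorphism C f" and g: "g \<in> Hom C B D" "isomorphism C g"
  shows "isomorphism C (g \<cdot> f)"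
proof -
  obtain f' where f': "f' \<in> Hom C B A" "f' \<cdot> f = Id C A" "f \<cdot> f' = Id C B"
    using isomorphismE f by metis
  obtain g' where g': "g' \<in> Hom C D B" "g' \<cdot> g = Id C B" "g \<cdot> g' = Id C D"
    using isomorphismE g by metis
  have "(f' \<cdot> g') \<cdot> (g \<cdot> f) = f' \<cdot> ((g' \<cdot> g) \<cdot> f)"
    using f(1) g(1) f'(1) g'(1) by (simp add: Hom_def)
  moreover have "(g \<cdot> f) \<cdot> (f' \<cdot> g') = g \<cdot> ((f \<cdot> f') \<cdot> g')"
    using f(1) g(1) f'(1) g'(1) by (simp add: Hom_def)
  ultimately show ?thesis
    using isomorphismI[OF Comp_Hom[OF f(1) g(1)] Comp_Hom[OF g'(1) f'(1)]] f' g'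
      Id_Comp[OF f(1)] Id_Comp[OF g'(1)] by simp
qed

lemma isomorphism_Comp_cancel_left:
  assumes f: "f \<in> Hom C A B" and g: "g \<in> Hom C B D" "isomorphism C g"
    and gf: "isomorphism C (g \<cdot> f)"
  shows "isomorphism C f"
proof -
  obtain g' where g': "g' \<in> Hom C D B" "g' \<cdot> g = Id C B" "g \<cdot> g' = Id C D"
    using isomorphismE g by metis
  then have "isomorphism C g'" using isomorphismI g(1) by metis
  then have "isomorphism C (g' \<cdot> (g \<cdot> f))"
    using isomorphism_Comp[OF Comp_Hom[OF f g(1)] gf g'(1)] by simp
  then show ?thesis
    using Comp_assoc[OF f g(1) g'(1)] g'(2) Id_Comp[OF f] by simp
qed

text \<open>If \<open>l\<close> inverts \<open>k \<cdot> h\<close> and \<open>r\<close> inverts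
  \<open>h \<cdot> k\<close>, then \<open>l \<cdot> k\<close> is a left inverse and
  \<open>k \<cdot> r\<close> a right inverse of \<open>h\<close>. This serves when a candidate
  inverse is correct only up to automorphisms.\<close>

lemma isomorphism_of_composites:
  assumes h: "h \<in> Hom C A B" and k: "k \<in> Hom C B A"
    and kh: "isomorphism C (k \<cdot> h)" and hk: "isomorphism C (h \<cdot> k)"
  shows "isomorphism C h"
proof -
  obtain l where l: "l \<in> Hom C A A" "l \<cdot> (k \<cdot> h) = Id C A"
    using isomorphismE[OF kh Comp_Hom[OF h k]] by metis
  obtain r where r: "r \<in> Hom C B B" "(h \<cdot> k) \<cdot> r = Id C B"
    using isomorphismE[OF hk Comp_Hom[OF k h]] by metis
  show ?thesis
    using isomorphism_left_right_inverse[OF h Comp_Hom[OF k l(1)] Comp_Hom[OF r(1) k]]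
      l(2) r(2) Comp_assoc[OF h k l(1)] Comp_assoc[OF r(1) k h] by simp
qed

lemma isomorphic_sym:
  assumes "isomorphic C A B"
  shows "isomorphic C B A"
proof -
  obtain f where f: "f \<in> Hom C A B" "isomorphism C f"
    using assms unfolding isomorphic_def by auto
  obtain g where g: "g \<in> Hom C B A" "g \<cdot> f = Id C A" "f \<cdot> g = Id C B"
    using isomorphismE f by metis
  then show ?thesis
    unfolding isomorphic_def using isomorphismI[OF g(1) f(1)] by auto
qed

end

lemma on_Ob_id_functor [simp]: "on_Ob id_functor A = A"
  and on_Arr_id_functor [simp]: "on_Arr id_functor f = f"
  by (simp_all add: id_functor_def)

lemma on_Ob_comp_functor [simp]: "on_Ob (G \<circ>\<^sub>F F) A = on_Ob G (on_Ob F A)"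
  and on_Arr_comp_functor [simp]: "on_Arr (G \<circ>\<^sub>F F) f = on_Arr G (on_Arr F f)"
  by (simp_all add: comp_functor_def)

context is_functor
begin

lemma isomorphism_on_Arr:
  assumes "isomorphism C f"
  shows "isomorphism D (on_Arr F f)"
proof -
  have f: "f \<in> Hom C (Dom C f) (Cod C f)" (is "_ \<in> Hom C ?A ?B")
    using assms by (auto simp: isomorphism_def Hom_def)
  obtain g where g: "g \<in> Hom C ?B ?A" "g \<cdot>\<^bsub>C\<^esub> f = Id C ?A" "f \<cdot>\<^bsub>C\<^esub> g = Id C ?B"
    using source.isomorphismE[OF assms f] by metis
  have "on_Arr F g \<cdot>\<^bsub>D\<^esub> on_Arr F f = Id D (on_Ob F ?A)"
    using on_Arr_Comp[OF f g(1)] g(2) on_Arr_Id source.Hom_Ob[OF f] by simp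
  moreover have "on_Arr F f \<cdot>\<^bsub>D\<^esub> on_Arr F g = Id D (on_Ob F ?B)"
    using on_Arr_Comp[OF g(1) f] g(3) on_Arr_Id source.Hom_Ob[OF f] by simp
  ultimately show ?thesis
    using target.isomorphismI[OF on_Arr_Hom[OF f] on_Arr_Hom[OF g(1)]] by simp
qed

end

lemma is_functor_comp_functor:
  assumes "is_functor C D F" "is_functor D E G"
  shows "is_functor C E (G \<circ>\<^sub>F F)"
proof -
  interpret F: is_functor C D F by fact
  interpret G: is_functor D E G by fact
  show ?thesis
  proof unfold_locales
    show "on_Arr (G \<circ>\<^sub>F F) (g \<cdot>\<^bsub>C\<^esub> f) = on_Arr (G \<circ>\<^sub>F F) g \<cdot>\<^bsub>E\<^esub> on_Arr (G \<circ>\<^sub>F F) f"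
      if "f \<in> Hom C A B" "g \<in> Hom C B B'" for f g A B B'
      using F.on_Arr_Comp[OF that] G.on_Arr_Comp[OF F.on_Arr_Hom[OF that(1)] F.on_Arr_Hom[OF that(2)]]
      by simp
  qed (auto simp: F.on_Ob_Ob G.on_Ob_Ob F.on_Arr_Id G.on_Arr_Id intro: F.on_Arr_Hom G.on_Arr_Hom)
qed

section \<open>Equivalences are fully faithful and dense\<close>

text \<open>Naturality reads \<open>f \<cdot> \<tau> A = \<tau> B \<cdot> G (F f)\<close>, so
  \<open>F f\<close> determines \<open>f \<cdot> \<tau> A\<close>, and the isomorphism
  \<open>\<tau> A\<close> can be cancelled.\<close>

lemma faithful_of_retract:
  assumes "is_functor C D F" "naturally_isomorphic C C (G \<circ>\<^sub>F F) id_functor"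
  shows "faithful C F"
  unfolding faithful_def
proof (intro ballI inj_onI)
  fix A B f g
  assume fg: "f \<in> Hom C A B" "g \<in> Hom C A B" "on_Arr F f = on_Arr F g"
  obtain \<tau> where "natural_isomorphism C C (G \<circ>\<^sub>F F) id_functor \<tau>"
    using assms unfolding naturally_isomorphic_def by auto
  then interpret N: natural_isomorphism C C "G \<circ>\<^sub>F F" id_functor \<tau> .
  have A: "A \<in> Ob C" using N.F.source.Hom_Ob fg by metis
  have "f \<cdot>\<^bsub>C\<^esub> \<tau> A = g \<cdot>\<^bsub>C\<^esub> \<tau> A"
    using N.natural[OF fg(1)] N.natural[OF fg(2)] fg(3) by simp
  then show "f = g"
    using N.F.source.isomorphism_cancel_right[OF N.component_iso[OF A]] N.component[OF A] fg
    by auto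
qed

lemma equivalence_functor_fully_faithful:
  assumes "equivalence_functor C D F"
  shows "fully_faithful C D F"
proof -
  interpret F: is_functor C D F using assms unfolding equivalence_functor_def by auto
  obtain G where G: "is_functor D C G"
    and GF: "naturally_isomorphic C C (G \<circ>\<^sub>F F) id_functor"
    and FG: "naturally_isomorphic D D (F \<circ>\<^sub>F G) id_functor"
    using assms unfolding equivalence_functor_def by auto
  interpret G: is_functor D C G by fact
  obtain \<tau> where "natural_isomorphism C C (G \<circ>\<^sub>F F) id_functor \<tau>"
    using GF unfolding naturally_isomorphic_def by auto
  then interpret N: natural_isomorphism C C "G \<circ>\<^sub>F F" id_functor \<tau> .
  have "full C D F"
    unfolding full_def
  proof (intro ballI)
    fix A B g
    assume A: "A \<in> Ob C" and B: "B \<in> Ob C" and g: "g \<in> Hom D (on_Ob F A) (on_Ob F B)"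
    have \<tau>A: "\<tau> A \<in> Hom C (on_Ob G (on_Ob F A)) A" and \<tau>B: "\<tau> B \<in> Hom C (on_Ob G (on_Ob F B)) B"
      using N.component[OF A] N.component[OF B] by simp_all
    obtain t where t: "t \<in> Hom C A (on_Ob G (on_Ob F A))" "t \<cdot>\<^bsub>C\<^esub> \<tau> A = Id C (on_Ob G (on_Ob F A))"
      using F.source.isomorphismE[OF N.component_iso[OF A] \<tau>A] by metis
    \<comment> \<open>The preimage of \<open>g\<close> is \<open>G g\<close> conjugated by
      \<open>\<tau>\<close>. Naturality then gives \<open>G (F f) = G g\<close>, and
      \<open>G\<close> is faithful because \<open>F \<circ>\<^sub>F G\<close> is isomorphic to the
      identity.\<close>
    define f where "f = \<tau> B \<cdot>\<^bsub>C\<^esub> (on_Arr G g \<cdot>\<^bsub>C\<^esub> t)"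
    have Gg: "on_Arr G g \<in> Hom C (on_Ob G (on_Ob F A)) (on_Ob G (on_Ob F B))"
      using G.on_Arr_Hom[OF g] .
    have f: "f \<in> Hom C A B"
      unfolding f_def using t(1) \<tau>B Gg F.source.Comp_Hom by metis
    have "\<tau> B \<cdot>\<^bsub>C\<^esub> on_Arr G (on_Arr F f) = f \<cdot>\<^bsub>C\<^esub> \<tau> A"
      using N.natural[OF f] by simp
    also have "\<dots> = \<tau> B \<cdot>\<^bsub>C\<^esub> (on_Arr G g \<cdot>\<^bsub>C\<^esub> (t \<cdot>\<^bsub>C\<^esub> \<tau> A))"
      unfolding f_def using t(1) \<tau>B Gg \<tau>A by (simp add: Hom_def)
    also have "\<dots> = \<tau> B \<cdot>\<^bsub>C\<^esub> on_Arr G g"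
      using F.source.Comp_Id[OF Gg] t(2) by simp
    finally have "on_Arr G (on_Arr F f) = on_Arr G g"
      using F.source.isomorphism_cancel_left[OF N.component_iso[OF B] \<tau>B _ Gg]
        G.on_Arr_Hom[OF F.on_Arr_Hom[OF f]] by metis
    then have "on_Arr F f = g"
      using faithful_of_retract[OF G FG] F.on_Arr_Hom[OF f] g F.on_Ob_Ob A B
      unfolding faithful_def inj_on_def by metis
    then show "\<exists>f \<in> Hom C A B. on_Arr F f = g" using f by auto
  qed
  then show ?thesis
    unfolding fully_faithful_def using faithful_of_retract[OF F.is_functor_axioms GF] by simp
qed

lemma equivalence_functor_dense:
  assumes "equivalence_functor C D F"
  shows "dense C D F"
  unfolding dense_def
proof
  fix B assume B: "B \<in> Ob D"
  obtain G where G: "is_functor D C G" and FG: "naturally_isomorphic D D (F \<circ>\<^sub>F G) id_functor"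
    using assms unfolding equivalence_functor_def by auto
  obtain \<sigma> where "natural_isomorphism D D (F \<circ>\<^sub>F G) id_functor \<sigma>"
    using FG unfolding naturally_isomorphic_def by auto
  then interpret N: natural_isomorphism D D "F \<circ>\<^sub>F G" id_functor \<sigma> .
  show "\<exists>A \<in> Ob C. isomorphic D (on_Ob F A) B"
    using N.component[OF B] N.component_iso[OF B] is_functor.on_Ob_Ob[OF G B]
    unfolding isomorphic_def by auto
qed

lemma fully_faithfulE:
  assumes "fully_faithful C D F" "g \<in> Hom D (on_Ob F A) (on_Ob F B)" "A \<in> Ob C" "B \<in> Ob C"
  obtains f where "f \<in> Hom C A B" "on_Arr F f = g"
  using assms unfolding fully_faithful_def full_def by metis

lemma fully_faithfulD:
  assumes "fully_faithful C D F" "A \<in> Ob C" "B \<in> Ob C" "f \<in> Hom C A B" "g \<in> Hom C A B"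
    "on_Arr F f = on_Arr F g"
  shows "f = g"
  using assms unfolding fully_faithful_def faithful_def inj_on_def by metis

section \<open>Units, counits and transposes\<close>

context adjunction
begin

lemma unit_Hom: "A \<in> Ob C \<Longrightarrow> \<eta> A \<in> Hom C A (on_Ob R (on_Ob L A))"
  using unit.component by simp

lemma counit_Hom: "B \<in> Ob D \<Longrightarrow> \<epsilon> B \<in> Hom D (on_Ob L (on_Ob R B)) B"
  using counit.component by simp

lemma unit_natural: "f \<in> Hom C A B \<Longrightarrow> \<eta> B \<cdot>\<^bsub>C\<^esub> f = on_Arr R (on_Arr L f) \<cdot>\<^bsub>C\<^esub> \<eta> A"
  using unit.natural by simp

lemma counit_natural: "f \<in> Hom D A B \<Longrightarrow> \<epsilon> B \<cdot>\<^bsub>D\<^esub> on_Arr L (on_Arr R f) = f \<cdot>\<^bsub>D\<^esub> \<epsilon> A"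
  using counit.natural by simp

text \<open>The inverse is the preimage \<open>s\<close> under \<open>R\<close> of the unit at
  \<open>R B\<close>. That \<open>\<epsilon> B \<cdot> s\<close> is the identity can be tested after
  \<open>R\<close>, where it is a triangle identity; the other composite is evaluated by naturality
  of the counit and the other triangle identity.\<close>

lemma counit_isomorphism:
  assumes ff: "fully_faithful D C R" and B: "B \<in> Ob D"
  shows "isomorphism D (\<epsilon> B)"
proof -
  note e = counit_Hom[OF B] and RB = right.on_Ob_Ob[OF B]
  note LRB = left.on_Ob_Ob[OF RB]
  obtain s where s: "s \<in> Hom D B (on_Ob L (on_Ob R B))" "on_Arr R s = \<eta> (on_Ob R B)"
    using fully_faithfulE[OF ff unit_Hom[OF RB] B LRB] .
  have "on_Arr R (\<epsilon> B \<cdot>\<^bsub>D\<^esub> s) = on_Arr R (Id D B)"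
    using triangle_right[OF B] right.on_Arr_Comp[OF s(1) e] s(2) right.on_Arr_Id[OF B] by simp
  then have es: "\<epsilon> B \<cdot>\<^bsub>D\<^esub> s = Id D B"
    using fully_faithfulD[OF ff B B] left.target.Comp_Hom[OF s(1) e] left.target.Id_Hom[OF B]
    by metis
  have "s \<cdot>\<^bsub>D\<^esub> \<epsilon> B = Id D (on_Ob L (on_Ob R B))"
    using counit_natural[OF s(1)] s(2) triangle_left[OF RB] by simp
  then show ?thesis using left.target.isomorphismI[OF e s(1)] es by simp
qed

text \<open>Dually, the inverse is the preimage under \<open>L\<close> of the counit at
  \<open>L A\<close>.\<close>

lemma unit_isomorphism:
  assumes ff: "fully_faithful C D L" and A: "A \<in> Ob C"
  shows "isomorphism C (\<eta> A)"
proof -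
  note n = unit_Hom[OF A] and LA = left.on_Ob_Ob[OF A]
  note RLA = right.on_Ob_Ob[OF LA]
  obtain t where t: "t \<in> Hom C (on_Ob R (on_Ob L A)) A" "on_Arr L t = \<epsilon> (on_Ob L A)"
    using fully_faithfulE[OF ff counit_Hom[OF LA] RLA A] .
  have "on_Arr L (t \<cdot>\<^bsub>C\<^esub> \<eta> A) = on_Arr L (Id C A)"
    using triangle_left[OF A] left.on_Arr_Comp[OF n t(1)] t(2) left.on_Arr_Id[OF A] by simp
  then have tn: "t \<cdot>\<^bsub>C\<^esub> \<eta> A = Id C A"
    using fully_faithfulD[OF ff A A] left.source.Comp_Hom[OF n t(1)] left.source.Id_Hom[OF A]
    by metis
  have "\<eta> A \<cdot>\<^bsub>C\<^esub> t = Id C (on_Ob R (on_Ob L A))"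
    using unit_natural[OF t(1)] t(2) triangle_right[OF LA] by simp
  then show ?thesis using left.source.isomorphismI[OF n t(1)] tn by simp
qed

text \<open>Naturality of the unit moves \<open>g\<close> to the far right, and the triangle
  identity at \<open>B\<close> collapses what stands before it.\<close>

lemma right_transpose_eq:
  assumes A: "A \<in> Ob C" and B: "B \<in> Ob D" and g: "g \<in> Hom C A (on_Ob R B)"
  shows "on_Arr R (\<epsilon> B \<cdot>\<^bsub>D\<^esub> on_Arr L g) \<cdot>\<^bsub>C\<^esub> \<eta> A = g"
proof -
  note Lg = left.on_Arr_Hom[OF g]
  have "on_Arr R (\<epsilon> B \<cdot>\<^bsub>D\<^esub> on_Arr L g) \<cdot>\<^bsub>C\<^esub> \<eta> A
      = on_Arr R (\<epsilon> B) \<cdot>\<^bsub>C\<^esub> (on_Arr R (on_Arr L g) \<cdot>\<^bsub>C\<^esub> \<eta> A)"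
    using right.on_Arr_Comp[OF Lg counit_Hom[OF B]]
      left.source.Comp_assoc[OF unit_Hom[OF A] right.on_Arr_Hom[OF Lg]
        right.on_Arr_Hom[OF counit_Hom[OF B]]] by simp
  also have "\<dots> = (on_Arr R (\<epsilon> B) \<cdot>\<^bsub>C\<^esub> \<eta> (on_Ob R B)) \<cdot>\<^bsub>C\<^esub> g"
    using unit_natural[OF g] left.source.Comp_assoc[OF g unit_Hom[OF right.on_Ob_Ob[OF B]]
        right.on_Arr_Hom[OF counit_Hom[OF B]]] by simp
  also have "\<dots> = g"
    using triangle_right[OF B] left.source.Id_Comp[OF g] by simp
  finally show ?thesis .
qed

lemma transpose_inj:
  assumes "A \<in> Ob C" "B \<in> Ob D" "g \<in> Hom C A (on_Ob R B)" "g' \<in> Hom C A (on_Ob R B)"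
    and "\<epsilon> B \<cdot>\<^bsub>D\<^esub> on_Arr L g = \<epsilon> B \<cdot>\<^bsub>D\<^esub> on_Arr L g'"
  shows "g = g'"
  using right_transpose_eq assms by metis

end

section \<open>Additive categories\<close>

context additive_category
begin

lemma hom_group_simps:
  "carrier (hom_group C A B) = Hom C A B" "f \<otimes>\<^bsub>hom_group C A B\<^esub> g = f \<oplus> g"
  "\<one>\<^bsub>hom_group C A B\<^esub> = Zero C A B"
  by (simp_all add: hom_group_def)

lemma Zero_Hom:
  assumes "A \<in> Ob C" "B \<in> Ob C"
  shows "Zero C A B \<in> Hom C A B"
proof -
  interpret G: comm_group "hom_group C A B" using hom_comm_group assms .
  show ?thesis using G.one_closed by (simp add: hom_group_simps)
qed

context
  fixes A B f
  assumes f: "f \<in> Hom C A B"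
begin

interpretation G: comm_group "hom_group C A B"
  using hom_comm_group Hom_Ob[OF f] .

lemma Minus_eq: "Minus C f = inv\<^bsub>hom_group C A B\<^esub> f"
  using f by (simp add: Minus_def Hom_def)

lemma Minus_Hom: "Minus C f \<in> Hom C A B"
  using G.inv_closed[of f] f by (simp add: Minus_eq hom_group_simps)

lemma Plus_Hom: "g \<in> Hom C A B \<Longrightarrow> f \<oplus> g \<in> Hom C A B"
  using G.m_closed[of f g] f by (simp add: hom_group_simps)

lemma Plus_Zero: "f \<oplus> Zero C A B = f"
  using G.r_one[of f] f by (simp add: hom_group_simps)

lemma Zero_Plus: "Zero C A B \<oplus> f = f"
  using G.l_one[of f] f by (simp add: hom_group_simps)

lemma Plus_Minus: "f \<oplus> Minus C f = Zero C A B"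
  using G.r_inv[of f] f by (simp add: Minus_eq hom_group_simps)

lemma Minus_Plus: "Minus C f \<oplus> f = Zero C A B"
  using G.l_inv[of f] f by (simp add: Minus_eq hom_group_simps)

lemma Minus_Minus: "Minus C (Minus C f) = f"
proof -
  have "Minus C (Minus C f) = inv\<^bsub>hom_group C A B\<^esub> (Minus C f)"
    using Minus_Hom by (simp add: Minus_def Hom_def)
  then show ?thesis using G.inv_inv[of f] f by (simp add: Minus_eq hom_group_simps)
qed

lemma Plus_commute: "g \<in> Hom C A B \<Longrightarrow> f \<oplus> g = g \<oplus> f"
  using G.m_comm[of f g] f by (simp add: hom_group_simps)

lemma Plus_assoc: "\<lbrakk>g \<in> Hom C A B; h \<in> Hom C A B\<rbrakk> \<Longrightarrow> (f \<oplus> g) \<oplus> h = f \<oplus> (g \<oplus> h)"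
  using G.m_assoc[of f g h] f by (simp add: hom_group_simps)

lemma Minus_unique: "\<lbrakk>g \<in> Hom C A B; f \<oplus> g = Zero C A B\<rbrakk> \<Longrightarrow> g = Minus C f"
  using G.inv_unique'[of f g] G.m_comm[of f g] f by (simp add: Minus_eq hom_group_simps)

lemma Plus_idem_Zero: "f \<oplus> f = f \<Longrightarrow> f = Zero C A B"
  using G.l_cancel_one[of f f] f by (simp add: hom_group_simps)

end

lemma Plus_Minus_cancel:
  assumes "f \<in> Hom C A B" "g \<in> Hom C A B"
  shows "f \<oplus> (g \<oplus> Minus C f) = g"
proof -
  note m = Minus_Hom[OF assms(1)]
  have "f \<oplus> (g \<oplus> Minus C f) = f \<oplus> (Minus C f \<oplus> g)"
    using Plus_commute[OF assms(2) m] by simp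
  also have "\<dots> = g"
    using Plus_assoc[OF assms(1) m assms(2)] Plus_Minus[OF assms(1)] Zero_Plus[OF assms(2)] by simp
  finally show ?thesis .
qed

lemma eq_of_diff_Zero:
  assumes "f \<in> Hom C A B" "g \<in> Hom C A B" "f \<oplus> Minus C g = Zero C A B"
  shows "f = g"
  using Plus_Minus_cancel[OF assms(2,1)] assms(3) Plus_Zero[OF assms(2)] by simp

text \<open>The composite is idempotent under addition, hence neutral in its Hom group.\<close>

lemma Comp_Zero:
  assumes g: "g \<in> Hom C B D" and A: "A \<in> Ob C"
  shows "g \<cdot> Zero C A B = Zero C A D"
proof -
  note z = Zero_Hom[OF A Hom_Ob(1)[OF g]]
  have "g \<cdot> Zero C A B = g \<cdot> Zero C A B \<oplus> g \<cdot> Zero C A B"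
    using Comp_Plus[OF z z g] Plus_Zero[OF z] by simp
  then show ?thesis using Plus_idem_Zero[OF Comp_Hom[OF z g]] by simp
qed

lemma Zero_Comp:
  assumes f: "f \<in> Hom C A B" and D: "D \<in> Ob C"
  shows "Zero C B D \<cdot> f = Zero C A D"
proof -
  note z = Zero_Hom[OF Hom_Ob(2)[OF f] D]
  have "Zero C B D \<cdot> f = Zero C B D \<cdot> f \<oplus> Zero C B D \<cdot> f"
    using Plus_Comp[OF f z z] Plus_Zero[OF z] by simp
  then show ?thesis using Plus_idem_Zero[OF Comp_Hom[OF f z]] by simp
qed

lemma Comp_Minus:
  assumes f: "f \<in> Hom C A B" and g: "g \<in> Hom C B D"
  shows "g \<cdot> Minus C f = Minus C (g \<cdot> f)"
proof -
  note m = Minus_Hom[OF f]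
  have "g \<cdot> f \<oplus> g \<cdot> Minus C f = Zero C A D"
    using Comp_Plus[OF f m g] Plus_Minus[OF f] Comp_Zero[OF g Hom_Ob(1)[OF f]] by simp
  then show ?thesis
    using Minus_unique[OF Comp_Hom[OF f g] Comp_Hom[OF m g]] by simp
qed

lemma Minus_Comp:
  assumes f: "f \<in> Hom C A B" and g: "g \<in> Hom C B D"
  shows "Minus C g \<cdot> f = Minus C (g \<cdot> f)"
proof -
  note m = Minus_Hom[OF g]
  have "g \<cdot> f \<oplus> Minus C g \<cdot> f = Zero C A D"
    using Plus_Comp[OF f g m] Plus_Minus[OF g] Zero_Comp[OF f Hom_Ob(2)[OF g]] by simp
  then show ?thesis
    using Minus_unique[OF Comp_Hom[OF f g] Comp_Hom[OF f m]] by simp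
qed

lemma Minus_Zero:
  assumes "A \<in> Ob C" "B \<in> Ob C"
  shows "Minus C (Zero C A B) = Zero C A B"
  using Minus_unique[OF Zero_Hom Zero_Hom] Plus_Zero[OF Zero_Hom] assms by simp

lemma Minus_inject:
  assumes "f \<in> Hom C A B" "g \<in> Hom C A B" "Minus C f = Minus C g"
  shows "f = g"
  using Minus_Minus assms by metis

text \<open>Turns the universal property into an equation between morphisms, which additive functors
  preserve.\<close>

lemma zero_object_iff:
  "zero_object C Z \<longleftrightarrow> Z \<in> Ob C \<and> Id C Z = Zero C Z Z"
proof
  assume z: "zero_object C Z"
  then have Z: "Z \<in> Ob C" by (simp add: zero_object_def)
  then have "\<exists>!f. f \<in> Hom C Z Z" using z by (simp add: zero_object_def)
  then show "Z \<in> Ob C \<and> Id C Z = Zero C Z Z"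
    using Z Id_Hom[OF Z] Zero_Hom[OF Z Z] by auto
next
  assume Z: "Z \<in> Ob C \<and> Id C Z = Zero C Z Z"
  have "f = Zero C A Z" if "f \<in> Hom C A Z" for A f
    using Id_Comp[OF that] Zero_Comp[OF that] Z by metis
  moreover have "f = Zero C Z A" if "f \<in> Hom C Z A" for A f
    using Comp_Id[OF that] Comp_Zero[OF that] Z by metis
  ultimately show "zero_object C Z"
    unfolding zero_object_def using Z Zero_Hom by metis
qed

lemma zero_object_to:
  assumes "zero_object C Z" "f \<in> Hom C A Z"
  shows "f = Zero C A Z"
  using Id_Comp[OF assms(2)] Zero_Comp[OF assms(2), of Z] assms(1) by (simp add: zero_object_iff)

lemma zero_object_from:
  assumes "zero_object C Z" "f \<in> Hom C Z A"
  shows "f = Zero C Z A"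
  using Comp_Id[OF assms(2)] Comp_Zero[OF assms(2), of Z] assms(1) by (simp add: zero_object_iff)

lemma zero_object_isomorphic:
  assumes "zero_object C Z" "isomorphism C f" "f \<in> Hom C A Z"
  shows "zero_object C A"
proof -
  obtain g where g: "g \<in> Hom C Z A" "g \<cdot> f = Id C A" using isomorphismE assms by metis
  have "Id C A = Zero C A A"
    using Comp_Zero[OF g(1) Hom_Ob(1)[OF assms(3)]] zero_object_to[OF assms(1,3)] g(2) by simp
  then show ?thesis using zero_object_iff Hom_Ob[OF assms(3)] by simp
qed

text \<open>The inverse is \<open>Id - n\<close>: both products equal
  \<open>Id - n \<cdot> n\<close>.\<close>

lemma isomorphism_unipotent:
  assumes n: "n \<in> Hom C A A" and nn: "n \<cdot> n = Zero C A A"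
  shows "isomorphism C (Id C A \<oplus> n)"
proof -
  have A: "A \<in> Ob C" using Hom_Ob n by metis
  note I = Id_Hom[OF A] and m = Minus_Hom[OF n]
  have mn: "Minus C n \<cdot> n = Zero C A A" "n \<cdot> Minus C n = Zero C A A"
    using Minus_Comp[OF n n] Comp_Minus[OF n n] nn Minus_Zero[OF A A] by simp_all
  have p: "Id C A \<oplus> n \<in> Hom C A A" and q: "Id C A \<oplus> Minus C n \<in> Hom C A A"
    using Plus_Hom I n m by simp_all
  have "(Id C A \<oplus> Minus C n) \<cdot> (Id C A \<oplus> n)
      = (Id C A \<oplus> Minus C n) \<cdot> Id C A \<oplus> (Id C A \<oplus> Minus C n) \<cdot> n"
    using Comp_Plus[OF I n q] .
  also have "\<dots> = (Id C A \<oplus> Minus C n) \<oplus> (n \<oplus> Zero C A A)"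
    using Comp_Id[OF q] Plus_Comp[OF n I m] Id_Comp[OF n] mn by simp
  also have "\<dots> = Id C A"
    using Plus_Zero[OF n] Plus_assoc[OF I m n] Minus_Plus[OF n] Plus_Zero[OF I] by simp
  finally have 1: "(Id C A \<oplus> Minus C n) \<cdot> (Id C A \<oplus> n) = Id C A" .
  have "(Id C A \<oplus> n) \<cdot> (Id C A \<oplus> Minus C n)
      = (Id C A \<oplus> n) \<cdot> Id C A \<oplus> (Id C A \<oplus> n) \<cdot> Minus C n"
    using Comp_Plus[OF I m p] .
  also have "\<dots> = (Id C A \<oplus> n) \<oplus> (Minus C n \<oplus> Zero C A A)"
    using Comp_Id[OF p] Plus_Comp[OF m I n] Id_Comp[OF m] mn by simp
  also have "\<dots> = Id C A"
    using Plus_Zero[OF m] Plus_assoc[OF I n m] Plus_Minus[OF n] Plus_Zero[OF I] by simp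
  finally show ?thesis using isomorphismI[OF p q 1] by simp
qed

end

context additive_functor
begin

lemma on_Arr_Zero:
  assumes "A \<in> Ob C" "B \<in> Ob C"
  shows "on_Arr F (Zero C A B) = Zero D (on_Ob F A) (on_Ob F B)"
proof -
  note z = source.Zero_Hom[OF assms]
  have "on_Arr F (Zero C A B) \<oplus>\<^bsub>D\<^esub> on_Arr F (Zero C A B) = on_Arr F (Zero C A B)"
    using on_Arr_Plus[OF z z] source.Plus_Zero[OF z] by simp
  then show ?thesis using target.Plus_idem_Zero[OF on_Arr_Hom[OF z]] by simp
qed

lemma on_Arr_Minus:
  assumes f: "f \<in> Hom C A B"
  shows "on_Arr F (Minus C f) = Minus D (on_Arr F f)"
proof -
  note m = source.Minus_Hom[OF f]
  have "on_Arr F f \<oplus>\<^bsub>D\<^esub> on_Arr F (Minus C f) = Zero D (on_Ob F A) (on_Ob F B)"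
    using on_Arr_Plus[OF f m] source.Plus_Minus[OF f] on_Arr_Zero source.Hom_Ob[OF f] by simp
  then show ?thesis
    using target.Minus_unique[OF on_Arr_Hom[OF f] on_Arr_Hom[OF m]] by simp
qed

lemma on_Ob_zero_object:
  assumes "zero_object C Z"
  shows "zero_object D (on_Ob F Z)"
  using assms source.zero_object_iff target.zero_object_iff on_Arr_Id on_Arr_Zero on_Ob_Ob by metis

end

section \<open>Triangulated categories\<close>

context triangulated_category
begin

sublocale Susp: additive_functor T T "Susp T"
  by (rule Susp_additive)

abbreviation Susp_Ob ("\<Sigma>\<^sub>o") where "\<Sigma>\<^sub>o \<equiv> on_Ob (Susp T)"
abbreviation Susp_Arr ("\<Sigma>\<^sub>a") where "\<Sigma>\<^sub>a \<equiv> on_Arr (Susp T)"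

text \<open>Arguments by rotation produce maps between suspensions; fullness of the equivalence
  \<Sigma> brings them back.\<close>

lemma Susp_lift:
  assumes "X \<in> Ob T" "Y \<in> Ob T" "g \<in> Hom T (\<Sigma>\<^sub>o X) (\<Sigma>\<^sub>o Y)"
  obtains f where "f \<in> Hom T X Y" "\<Sigma>\<^sub>a f = g"
  using fully_faithfulE[OF equivalence_functor_fully_faithful[OF Susp_equivalence] assms(3,1,2)] .

lemma Susp_inject:
  assumes "f \<in> Hom T X Y" "g \<in> Hom T X Y" "\<Sigma>\<^sub>a f = \<Sigma>\<^sub>a g"
  shows "f = g"
  using fully_faithfulD[OF equivalence_functor_fully_faithful[OF Susp_equivalence]]
    Hom_Ob[OF assms(1)] assms by metis

lemma exact_triangle_Hom:
  assumes "exact_triangle T X Y Z f g h"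
  shows "f \<in> Hom T X Y" "g \<in> Hom T Y Z" "h \<in> Hom T Z (\<Sigma>\<^sub>o X)"
  using assms unfolding exact_triangle_def triangle_def by auto

lemma exact_triangle_rotate:
  assumes "exact_triangle T X Y Z f g h"
  shows "exact_triangle T Y Z (\<Sigma>\<^sub>o X) g h (Minus T (\<Sigma>\<^sub>a f))"
  using assms TR2 unfolding exact_triangle_def by metis

text \<open>One rotation turns this into the identity triangle of \<open>X\<close> with third term
  \<Sigma> Z, which is again a zero object, so \<open>TR1_Id\<close> and TR2 apply.\<close>

lemma exact_triangle_Id_left:
  assumes "X \<in> Ob T" "zero_object T Z"
  shows "exact_triangle T Z X X (Zero T Z X) (Id T X) (Zero T X (\<Sigma>\<^sub>o Z))"
proof -
  have Z: "Z \<in> Ob T" and SZ: "zero_object T (\<Sigma>\<^sub>o Z)"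
    using assms Susp.on_Ob_zero_object by (auto simp: zero_object_iff)
  note SX = Susp.on_Ob_Ob[OF assms(1)] and SZo = Susp.on_Ob_Ob[OF Z]
  have "triangle T Z X X (Zero T Z X) (Id T X) (Zero T X (\<Sigma>\<^sub>o Z))"
    unfolding triangle_def using Zero_Hom Z assms(1) Id_Hom SZo by simp
  moreover have "Minus T (\<Sigma>\<^sub>a (Zero T Z X)) = Zero T (\<Sigma>\<^sub>o Z) (\<Sigma>\<^sub>o X)"
    using Susp.on_Arr_Zero[OF Z assms(1)] Minus_Zero[OF SZo SX] by simp
  ultimately show ?thesis
    using TR2 TR1_Id[OF assms(1) SZ] by metis
qed

text \<open>TR3 extends \<open>(Id, f)\<close> to a morphism from the identity triangle of
  \<open>X\<close>, so \<open>g \<cdot> f\<close> factors through a zero object.\<close>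

lemma exact_triangle_Comp_Zero:
  assumes e: "exact_triangle T X Y Z f g h"
  shows "g \<cdot> f = Zero T X Z"
proof -
  obtain O' where O': "zero_object T O'" using ex_zero_object by auto
  note H = exact_triangle_Hom[OF e]
  have X: "X \<in> Ob T" using Hom_Ob H by metis
  obtain c where c: "c \<in> Hom T O' Z" "c \<cdot> Zero T X O' = g \<cdot> f"
    using TR3[OF TR1_Id[OF X O'] e Id_Hom[OF X] H(1)] by auto
  then show ?thesis using Comp_Zero[OF c(1) X] by simp
qed

text \<open>Since \<open>p \<cdot> f = 0\<close>, the pair \<open>(0, p)\<close> maps the first
  arrow of the triangle to that of \<open>0 \<rightarrow> W \<rightarrow> W\<close>; the filler from
  TR3 is \<open>s\<close>.\<close>

lemma exact_triangle_weak_cokernel: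
  assumes e: "exact_triangle T X Y Z f g h" and p: "p \<in> Hom T Y W" and pf: "p \<cdot> f = Zero T X W"
  obtains s where "s \<in> Hom T Z W" "s \<cdot> g = p"
proof -
  obtain O' where O': "zero_object T O'" using ex_zero_object by auto
  note H = exact_triangle_Hom[OF e]
  have X: "X \<in> Ob T" and W: "W \<in> Ob T" using Hom_Ob H p by metis+
  have O'Ob: "O' \<in> Ob T" using O' zero_object_iff by simp
  have "p \<cdot> f = Zero T O' W \<cdot> Zero T X O'"
    using pf Zero_Comp[OF Zero_Hom[OF X O'Ob] W] by simp
  then show thesis
    using TR3[OF e exact_triangle_Id_left[OF W O'] Zero_Hom[OF X O'Ob] p] Id_Comp[OF p] that by auto
qed

text \<open>TR3 fills in third terms only, so the identity triangle of \<open>W\<close> and the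
  given one are both rotated, and the filler from \<Sigma> W to \<Sigma> X is desuspended. Both
  rotations introduce a sign, and the signs cancel.\<close>

lemma exact_triangle_weak_kernel:
  assumes e: "exact_triangle T X Y Z f g h" and r: "r \<in> Hom T W Y" and gr: "g \<cdot> r = Zero T W Z"
  obtains t where "t \<in> Hom T W X" "f \<cdot> t = r"
proof -
  obtain O' where O': "zero_object T O'" using ex_zero_object by auto
  note H = exact_triangle_Hom[OF e]
  have X: "X \<in> Ob T" and W: "W \<in> Ob T" and Z: "Z \<in> Ob T" using Hom_Ob H r by metis+
  have O'Ob: "O' \<in> Ob T" using O' zero_object_iff by simp
  note z = Zero_Hom[OF O'Ob Z]
  note SW = Susp.on_Ob_Ob[OF W]
  have "Zero T O' Z \<cdot> Zero T W O' = g \<cdot> r"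
    using gr Comp_Zero[OF z W] by simp
  then obtain c where c: "c \<in> Hom T (\<Sigma>\<^sub>o W) (\<Sigma>\<^sub>o X)"
    "\<Sigma>\<^sub>a r \<cdot> Minus T (\<Sigma>\<^sub>a (Id T W)) = Minus T (\<Sigma>\<^sub>a f) \<cdot> c"
    using TR3[OF exact_triangle_rotate[OF TR1_Id[OF W O']] exact_triangle_rotate[OF e] r z] by metis
  obtain t where t: "t \<in> Hom T W X" "\<Sigma>\<^sub>a t = c" using Susp_lift[OF W X c(1)] .
  note Sr = Susp.on_Arr_Hom[OF r] and Sf = Susp.on_Arr_Hom[OF H(1)]
  have "Minus T (\<Sigma>\<^sub>a r) = Minus T (\<Sigma>\<^sub>a f \<cdot> c)"
    using c(2) Comp_Minus[OF Id_Hom[OF SW] Sr] Comp_Id[OF Sr] Susp.on_Arr_Id[OF W]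
      Minus_Comp[OF c(1) Sf] by simp
  then have "\<Sigma>\<^sub>a r = \<Sigma>\<^sub>a (f \<cdot> t)"
    using Minus_inject[OF Sr Comp_Hom[OF c(1) Sf]] Susp.on_Arr_Comp[OF t(1) H(1)] t(2) by simp
  then show thesis using Susp_inject[OF r Comp_Hom[OF t(1) H(1)]] t(1) that by simp
qed

text \<open>Rotating twice makes \<Sigma> f, up to sign, a weak cokernel of
  \<open>h\<close>.\<close>

lemma exact_triangle_extend:
  assumes e: "exact_triangle T X Y Z f g h" and q: "q \<in> Hom T X W"
    and qh: "\<Sigma>\<^sub>a q \<cdot> h = Zero T Z (\<Sigma>\<^sub>o W)"
  obtains t where "t \<in> Hom T Y W" "t \<cdot> f = q"
proof -
  note H = exact_triangle_Hom[OF e]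
  have Y: "Y \<in> Ob T" and W: "W \<in> Ob T" using Hom_Ob H q by metis+
  note Sf = Susp.on_Arr_Hom[OF H(1)] and Sq = Susp.on_Arr_Hom[OF q]
  obtain s where s: "s \<in> Hom T (\<Sigma>\<^sub>o Y) (\<Sigma>\<^sub>o W)" "s \<cdot> Minus T (\<Sigma>\<^sub>a f) = \<Sigma>\<^sub>a q"
    using exact_triangle_weak_cokernel[OF exact_triangle_rotate[OF exact_triangle_rotate[OF e]] Sq qh]
    by metis
  obtain t where t: "t \<in> Hom T Y W" "\<Sigma>\<^sub>a t = s" using Susp_lift[OF Y W s(1)] .
  \<comment> \<open>The rotated triangle contains \<open>-\<Sigma> f\<close>, so the extension is
    \<open>-t\<close> rather than \<open>t\<close>.\<close>
  note mt = Minus_Hom[OF t(1)]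
  have "\<Sigma>\<^sub>a (Minus T t \<cdot> f) = \<Sigma>\<^sub>a q"
    using Susp.on_Arr_Comp[OF H(1) mt] Susp.on_Arr_Minus[OF t(1)] t(2) s(2)
      Minus_Comp[OF Sf s(1)] Comp_Minus[OF Sf s(1)] by simp
  then show thesis using Susp_inject[OF Comp_Hom[OF H(1) mt] q] mt that by simp
qed

text \<open>After two rotations \<open>h\<close> is a weak kernel of \<Sigma> f, and the latter
  kills \<Sigma> x.\<close>

lemma exact_triangle_coextend:
  assumes e: "exact_triangle T X Y Z f g h" and x: "x \<in> Hom T W X"
    and fx: "f \<cdot> x = Zero T W Y"
  obtains y where "y \<in> Hom T (\<Sigma>\<^sub>o W) Z" "h \<cdot> y = \<Sigma>\<^sub>a x"
proof -
  note H = exact_triangle_Hom[OF e]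
  have Y: "Y \<in> Ob T" and W: "W \<in> Ob T" using Hom_Ob H x by metis+
  note Sf = Susp.on_Arr_Hom[OF H(1)] and Sx = Susp.on_Arr_Hom[OF x]
  have "Minus T (\<Sigma>\<^sub>a f) \<cdot> \<Sigma>\<^sub>a x = Zero T (\<Sigma>\<^sub>o W) (\<Sigma>\<^sub>o Y)"
    using Minus_Comp[OF Sx Sf] Susp.on_Arr_Comp[OF x H(1)] fx Susp.on_Arr_Zero[OF W Y]
      Minus_Zero[OF Susp.on_Ob_Ob[OF W] Susp.on_Ob_Ob[OF Y]] by metis
  then show thesis
    using exact_triangle_weak_kernel[OF exact_triangle_rotate[OF exact_triangle_rotate[OF e]] Sx] that
    by metis
qed

text \<open>As \<open>g = 0\<close>, the identity of \<open>Y\<close> lifts through \<open>f\<close>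
  to a right inverse \<open>r\<close>. The difference \<open>r \<cdot> f - Id\<close> is killed by
  \<open>f\<close>, so its suspension factors through the zero object \<open>Z\<close>; hence
  \<open>r\<close> is also a left inverse.\<close>

lemma exact_triangle_isomorphism_left:
  assumes e: "exact_triangle T X Y Z f g h" and Z: "zero_object T Z"
  shows "isomorphism T f"
proof -
  note H = exact_triangle_Hom[OF e]
  have XO: "X \<in> Ob T" and YO: "Y \<in> Ob T" and ZO: "Z \<in> Ob T" using Hom_Ob H by metis+
  have "g \<cdot> Id T Y = Zero T Y Z"
    using zero_object_to[OF Z H(2)] Comp_Id[OF H(2)] by simp
  then obtain r where r: "r \<in> Hom T Y X" "f \<cdot> r = Id T Y"
    using exact_triangle_weak_kernel[OF e Id_Hom[OF YO]] by metis
  note rf = Comp_Hom[OF H(1) r(1)]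
  let ?d = "r \<cdot> f \<oplus> Minus T (Id T X)"
  note I = Id_Hom[OF XO]
  note d = Plus_Hom[OF rf Minus_Hom[OF I]]
  have "f \<cdot> ?d = f \<cdot> (r \<cdot> f) \<oplus> f \<cdot> Minus T (Id T X)"
    using Comp_Plus[OF rf Minus_Hom[OF I] H(1)] .
  also have "\<dots> = f \<oplus> Minus T f"
    using Comp_assoc[OF H(1) r(1) H(1)] r(2) Id_Comp[OF H(1)] Comp_Minus[OF I H(1)] Comp_Id[OF H(1)]
    by simp
  also have "\<dots> = Zero T X Y" using Plus_Minus[OF H(1)] .
  finally obtain y where y: "y \<in> Hom T (\<Sigma>\<^sub>o X) Z" "h \<cdot> y = \<Sigma>\<^sub>a ?d"
    using exact_triangle_coextend[OF e d] by metis
  have "h \<cdot> y = Zero T (\<Sigma>\<^sub>o X) (\<Sigma>\<^sub>o X)"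
    using zero_object_to[OF Z y(1)] Comp_Zero[OF H(3)] Susp.on_Ob_Ob[OF XO] by simp
  then have "\<Sigma>\<^sub>a ?d = \<Sigma>\<^sub>a (Zero T X X)"
    using y(2) Susp.on_Arr_Zero XO by simp
  then have "?d = Zero T X X"
    using Susp_inject[OF d Zero_Hom[OF XO XO]] by simp
  then have "r \<cdot> f = Id T X"
    using eq_of_diff_Zero[OF rf I] by simp
  then show ?thesis using isomorphismI[OF H(1) r(1)] r(2) by simp
qed

lemma exact_triangle_isomorphism_middle:
  assumes e: "exact_triangle T X Y Z f g h" and X: "zero_object T X"
  shows "isomorphism T g"
  using exact_triangle_isomorphism_left[OF exact_triangle_rotate[OF e]] Susp.on_Ob_zero_object[OF X]
  by simp

text \<open>TR1 prescribes the first map of a triangle only. So \<open>w\<close> is completed to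
  \<open>Z \<rightarrow> \<Sigma> X \<rightarrow> K\<close>, the object \<open>K\<close> is replaced
  by an isomorphic suspension, and TR2 is applied backwards twice.\<close>

lemma exact_triangle_complete_right:
  assumes w: "w \<in> Hom T Z (\<Sigma>\<^sub>o X)" and X: "X \<in> Ob T"
  obtains Y f g where "exact_triangle T X Y Z f g w"
proof -
  have Z: "Z \<in> Ob T" using Hom_Ob w by metis
  obtain K a b where e: "exact_triangle T Z (\<Sigma>\<^sub>o X) K w a b" using TR1_ex[OF w] by metis
  note H = exact_triangle_Hom[OF e]
  have K: "K \<in> Ob T" using Hom_Ob H by metis
  obtain Y where Y: "Y \<in> Ob T" "isomorphic T (\<Sigma>\<^sub>o Y) K"
    using equivalence_functor_dense[OF Susp_equivalence] K unfolding dense_def by auto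
  then obtain c where c: "c \<in> Hom T K (\<Sigma>\<^sub>o Y)" "isomorphism T c"
    using isomorphic_sym unfolding isomorphic_def by metis
  obtain d where d: "d \<in> Hom T (\<Sigma>\<^sub>o Y) K" "d \<cdot> c = Id T K"
    using isomorphismE[OF c(2,1)] by metis
  obtain f0 where f0: "f0 \<in> Hom T X Y" "\<Sigma>\<^sub>a f0 = c \<cdot> a"
    using Susp_lift[OF X Y(1) Comp_Hom[OF H(2) c(1)]] .
  obtain g0 where g0: "g0 \<in> Hom T Y Z" "\<Sigma>\<^sub>a g0 = b \<cdot> d"
    using Susp_lift[OF Y(1) Z Comp_Hom[OF d(1) H(3)]] .
  \<comment> \<open>The signs compensate those of the rotations, so that \<open>-\<Sigma> ?f\<close>
    and \<open>-\<Sigma> ?g\<close> are the second and third maps of the triangle on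
    \<open>w\<close>.\<close>
  let ?f = "Minus T f0" and ?g = "Minus T g0"
  have f: "?f \<in> Hom T X Y" and g: "?g \<in> Hom T Y Z" using Minus_Hom f0 g0 by auto
  have Sf: "Minus T (\<Sigma>\<^sub>a ?f) = c \<cdot> a" and Sg: "Minus T (\<Sigma>\<^sub>a ?g) = b \<cdot> d"
    using Susp.on_Arr_Minus[OF f0(1)] Susp.on_Arr_Minus[OF g0(1)] f0(2) g0(2)
      Minus_Minus[OF Susp.on_Arr_Hom[OF f0(1)]] Minus_Minus[OF Susp.on_Arr_Hom[OF g0(1)]] by simp_all
  have SX: "\<Sigma>\<^sub>o X \<in> Ob T" using Susp.on_Ob_Ob[OF X] .
  have isoId: "isomorphism T (Id T A)" if "A \<in> Ob T" for A
    using isomorphismI[OF Id_Hom[OF that] Id_Hom[OF that]] Comp_Id[OF Id_Hom[OF that]] by simp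
  have "exact_triangle T Z (\<Sigma>\<^sub>o X) (\<Sigma>\<^sub>o Y) w (c \<cdot> a) (b \<cdot> d)"
  proof (rule TR1_iso[OF e _ Id_Hom[OF Z] Id_Hom[OF SX] c(1) isoId[OF Z] isoId[OF SX] c(2)])
    show "triangle T Z (\<Sigma>\<^sub>o X) (\<Sigma>\<^sub>o Y) w (c \<cdot> a) (b \<cdot> d)"
      unfolding triangle_def using w Comp_Hom[OF H(2) c(1)] Comp_Hom[OF d(1) H(3)] by simp
    show "Id T (\<Sigma>\<^sub>o X) \<cdot> w = w \<cdot> Id T Z" using Id_Comp[OF w] Comp_Id[OF w] by simp
    show "c \<cdot> a = (c \<cdot> a) \<cdot> Id T (\<Sigma>\<^sub>o X)" using Comp_Id[OF Comp_Hom[OF H(2) c(1)]] by simp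
    show "\<Sigma>\<^sub>a (Id T Z) \<cdot> b = (b \<cdot> d) \<cdot> c"
      using Susp.on_Arr_Id[OF Z] Id_Comp[OF H(3)] Comp_assoc[OF c(1) d(1) H(3)] d(2) Comp_Id[OF H(3)]
      by simp
  qed
  then have "exact_triangle T Y Z (\<Sigma>\<^sub>o X) ?g w (Minus T (\<Sigma>\<^sub>a ?f))"
    using TR2[of Y Z "\<Sigma>\<^sub>o X" ?g w "Minus T (\<Sigma>\<^sub>a ?f)"] g w Sf Sg Comp_Hom[OF H(2) c(1)]
    by (simp add: triangle_def)
  then have "exact_triangle T X Y Z ?f ?g w"
    using TR2[of X Y Z ?f ?g w] f g w by (simp add: triangle_def)
  then show thesis using that by simp
qed

text \<open>Two rotations move the middle terms to third position, where TR3 applies. The filler is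
  desuspended; the signs occur on both sides of each square and cancel.\<close>

lemma TR3_middle:
  assumes e: "exact_triangle T X Y Z f g h" and e': "exact_triangle T X' Y' Z' f' g' h'"
    and a: "a \<in> Hom T X X'" and c: "c \<in> Hom T Z Z'" and eq: "\<Sigma>\<^sub>a a \<cdot> h = h' \<cdot> c"
  obtains b where "b \<in> Hom T Y Y'" "b \<cdot> f = f' \<cdot> a" "c \<cdot> g = g' \<cdot> b"
proof -
  note H = exact_triangle_Hom[OF e] and H' = exact_triangle_Hom[OF e']
  have Y: "Y \<in> Ob T" "Y' \<in> Ob T" using Hom_Ob H H' by metis+
  note S = Susp.on_Arr_Hom[OF H(1)] Susp.on_Arr_Hom[OF H(2)]
  note S' = Susp.on_Arr_Hom[OF H'(1)] Susp.on_Arr_Hom[OF H'(2)]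
  note Sa = Susp.on_Arr_Hom[OF a] and Sc = Susp.on_Arr_Hom[OF c]
  obtain b' where b': "b' \<in> Hom T (\<Sigma>\<^sub>o Y) (\<Sigma>\<^sub>o Y')"
    "b' \<cdot> Minus T (\<Sigma>\<^sub>a f) = Minus T (\<Sigma>\<^sub>a f') \<cdot> \<Sigma>\<^sub>a a"
    "\<Sigma>\<^sub>a c \<cdot> Minus T (\<Sigma>\<^sub>a g) = Minus T (\<Sigma>\<^sub>a g') \<cdot> b'"
    using TR3[OF exact_triangle_rotate[OF exact_triangle_rotate[OF e]]
        exact_triangle_rotate[OF exact_triangle_rotate[OF e']] c Sa eq] by metis
  obtain b where b: "b \<in> Hom T Y Y'" "\<Sigma>\<^sub>a b = b'" using Susp_lift[OF Y b'(1)] .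
  have "b' \<cdot> \<Sigma>\<^sub>a f = \<Sigma>\<^sub>a f' \<cdot> \<Sigma>\<^sub>a a"
    using b'(2) Comp_Minus[OF S(1) b'(1)] Minus_Comp[OF Sa S'(1)]
      Minus_inject[OF Comp_Hom[OF S(1) b'(1)] Comp_Hom[OF Sa S'(1)]] by simp
  then have "\<Sigma>\<^sub>a (b \<cdot> f) = \<Sigma>\<^sub>a (f' \<cdot> a)"
    using Susp.on_Arr_Comp[OF H(1) b(1)] Susp.on_Arr_Comp[OF a H'(1)] b(2) by simp
  then have 1: "b \<cdot> f = f' \<cdot> a"
    using Susp_inject[OF Comp_Hom[OF H(1) b(1)] Comp_Hom[OF a H'(1)]] by simp
  have "\<Sigma>\<^sub>a c \<cdot> \<Sigma>\<^sub>a g = \<Sigma>\<^sub>a g' \<cdot> b'"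
    using b'(3) Comp_Minus[OF S(2) Sc] Minus_Comp[OF b'(1) S'(2)]
      Minus_inject[OF Comp_Hom[OF S(2) Sc] Comp_Hom[OF b'(1) S'(2)]] by simp
  then have "\<Sigma>\<^sub>a (c \<cdot> g) = \<Sigma>\<^sub>a (g' \<cdot> b)"
    using Susp.on_Arr_Comp[OF H(2) c] Susp.on_Arr_Comp[OF b(1) H'(2)] b(2) by simp
  then have 2: "c \<cdot> g = g' \<cdot> b"
    using Susp_inject[OF Comp_Hom[OF H(2) c] Comp_Hom[OF b(1) H'(2)]] by simp
  show thesis using that[OF b(1) 1 2] .
qed

end

lemma triangle_functor_additive:
  "triangle_functor S T F \<Longrightarrow> additive_functor S T F"
  unfolding triangle_functor_def by simp

lemma triangle_functor_exact:
  assumes "triangle_functor S T F" "exact_triangle S X Y Z f g h"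
  obtains h' where "exact_triangle T (on_Ob F X) (on_Ob F Y) (on_Ob F Z) (on_Arr F f) (on_Arr F g) h'"
  using assms unfolding triangle_functor_def by metis

section \<open>Comma categories\<close>

lemma comma_Ob_iff:
  "(A, B, f) \<in> Ob (comma C D F) \<longleftrightarrow> A \<in> Ob C \<and> B \<in> Ob D \<and> f \<in> Hom D (on_Ob F A) B"
  by (simp add: comma_def Let_def)

lemma comma_Hom_iff:
  "m \<in> Hom (comma C D F) (A, B, f) (A', B', f') \<longleftrightarrow>
    (A, B, f) \<in> Ob (comma C D F) \<and> (A', B', f') \<in> Ob (comma C D F) \<and>
    (\<exists>a \<in> Hom C A A'. \<exists>b \<in> Hom D B B'. m = ((A, B, f), (A', B', f'), a, b) \<and>
      f' \<cdot>\<^bsub>D\<^esub> on_Arr F a = b \<cdot>\<^bsub>D\<^esub> f)"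
  by (auto simp: comma_def Let_def Hom_def)

lemma comma_Comp [simp]:
  "(Y', Z, a', b') \<cdot>\<^bsub>comma C D F\<^esub> (X, Y, a, b) = (X, Z, a' \<cdot>\<^bsub>C\<^esub> a, b' \<cdot>\<^bsub>D\<^esub> b)"
  by (simp add: comma_def Let_def)

lemma comma_Id [simp]:
  "Id (comma C D F) (A, B, f) = ((A, B, f), (A, B, f), Id C A, Id D B)"
  by (simp add: comma_def Let_def)

context is_functor
begin

lemma comma_HomI:
  assumes "f \<in> Hom D (on_Ob F A) B" "f' \<in> Hom D (on_Ob F A') B'" "a \<in> Hom C A A'" "b \<in> Hom D B B'"
    and "f' \<cdot>\<^bsub>D\<^esub> on_Arr F a = b \<cdot>\<^bsub>D\<^esub> f"
  shows "((A, B, f), (A', B', f'), a, b) \<in> Hom (comma C D F) (A, B, f) (A', B', f')"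
  unfolding comma_Hom_iff comma_Ob_iff
  using assms source.Hom_Ob[OF assms(3)] target.Hom_Ob[OF assms(4)] by auto

lemma category_comma: "category (comma C D F)"
proof
  fix m assume "m \<in> Arr (comma C D F)"
  then show "Dom (comma C D F) m \<in> Ob (comma C D F)" "Cod (comma C D F) m \<in> Ob (comma C D F)"
    by (auto simp: comma_def Let_def)
next
  fix X assume "X \<in> Ob (comma C D F)"
  moreover obtain A B f where X: "X = (A, B, f)" by (cases X)
  ultimately have "A \<in> Ob C" "B \<in> Ob D" "f \<in> Hom D (on_Ob F A) B" by (simp_all add: comma_Ob_iff)
  then show "Id (comma C D F) X \<in> Hom (comma C D F) X X"
    unfolding X comma_Id
    by (intro comma_HomI) (simp_all add: source.Id_Hom target.Id_Hom on_Arr_Id target.Comp_Id target.Id_Comp)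
next
  fix m m' X Y Z
  assume m: "m \<in> Hom (comma C D F) X Y" and m': "m' \<in> Hom (comma C D F) Y Z"
  obtain A B f A' B' f' A'' B'' f''
    where X: "X = (A, B, f)" and Y: "Y = (A', B', f')" and Z: "Z = (A'', B'', f'')"
    by (cases X, cases Y, cases Z)
  obtain a b where ab: "m = (X, Y, a, b)" "a \<in> Hom C A A'" "b \<in> Hom D B B'"
    "f' \<cdot>\<^bsub>D\<^esub> on_Arr F a = b \<cdot>\<^bsub>D\<^esub> f" and f: "f \<in> Hom D (on_Ob F A) B" "f' \<in> Hom D (on_Ob F A') B'"
    using m unfolding X Y comma_Hom_iff comma_Ob_iff by auto
  obtain a' b' where ab': "m' = (Y, Z, a', b')" "a' \<in> Hom C A' A''" "b' \<in> Hom D B' B''"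
    "f'' \<cdot>\<^bsub>D\<^esub> on_Arr F a' = b' \<cdot>\<^bsub>D\<^esub> f'" and f'': "f'' \<in> Hom D (on_Ob F A'') B''"
    using m' unfolding Y Z comma_Hom_iff comma_Ob_iff by auto
  note Fa = on_Arr_Hom[OF ab(2)] and Fa' = on_Arr_Hom[OF ab'(2)]
  have "f'' \<cdot>\<^bsub>D\<^esub> on_Arr F (a' \<cdot>\<^bsub>C\<^esub> a) = (f'' \<cdot>\<^bsub>D\<^esub> on_Arr F a') \<cdot>\<^bsub>D\<^esub> on_Arr F a"
    using on_Arr_Comp[OF ab(2) ab'(2)] target.Comp_assoc[OF Fa Fa' f''] by simp
  also have "\<dots> = b' \<cdot>\<^bsub>D\<^esub> (b \<cdot>\<^bsub>D\<^esub> f)"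
    using ab'(4) target.Comp_assoc[OF Fa f(2) ab'(3)] ab(4) by simp
  also have "\<dots> = (b' \<cdot>\<^bsub>D\<^esub> b) \<cdot>\<^bsub>D\<^esub> f"
    using target.Comp_assoc[OF f(1) ab(3) ab'(3)] .
  finally show "m' \<cdot>\<^bsub>comma C D F\<^esub> m \<in> Hom (comma C D F) X Z"
    unfolding ab(1) ab'(1) comma_Comp X Z
    by (intro comma_HomI[OF f(1) f'' source.Comp_Hom[OF ab(2) ab'(2)] target.Comp_Hom[OF ab(3) ab'(3)]])
next
  fix m X Y
  assume "m \<in> Hom (comma C D F) X Y"
  then show "m \<cdot>\<^bsub>comma C D F\<^esub> Id (comma C D F) X = m" "Id (comma C D F) Y \<cdot>\<^bsub>comma C D F\<^esub> m = m"
    by (cases X; cases Y;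
        auto simp: comma_Hom_iff source.Comp_Id source.Id_Comp target.Comp_Id target.Id_Comp)+
next
  fix m m' m'' W X Y Z
  assume "m \<in> Hom (comma C D F) W X" "m' \<in> Hom (comma C D F) X Y" "m'' \<in> Hom (comma C D F) Y Z"
  then show "m'' \<cdot>\<^bsub>comma C D F\<^esub> (m' \<cdot>\<^bsub>comma C D F\<^esub> m)
      = (m'' \<cdot>\<^bsub>comma C D F\<^esub> m') \<cdot>\<^bsub>comma C D F\<^esub> m"
    by (cases W; cases X; cases Y; cases Z; clarsimp simp: comma_Hom_iff)
      (simp add: Hom_def)
qed

text \<open>The componentwise inverses satisfy the comma condition: composed with \<open>b\<close>,
  both sides become \<open>f'\<close>, and \<open>b\<close> can be cancelled.\<close>

lemma comma_isomorphismI: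
  assumes f: "f \<in> Hom D (on_Ob F A) B" and f': "f' \<in> Hom D (on_Ob F A') B'"
    and a: "a \<in> Hom C A A'" "isomorphism C a" and b: "b \<in> Hom D B B'" "isomorphism D b"
    and eq: "f' \<cdot>\<^bsub>D\<^esub> on_Arr F a = b \<cdot>\<^bsub>D\<^esub> f"
  shows "isomorphism (comma C D F) ((A, B, f), (A', B', f'), a, b)"
proof -
  interpret comma: category "comma C D F" by (rule category_comma)
  obtain a' where a': "a' \<in> Hom C A' A" "a' \<cdot>\<^bsub>C\<^esub> a = Id C A" "a \<cdot>\<^bsub>C\<^esub> a' = Id C A'"
    using source.isomorphismE[OF a(2,1)] .
  obtain b' where b': "b' \<in> Hom D B' B" "b' \<cdot>\<^bsub>D\<^esub> b = Id D B" "b \<cdot>\<^bsub>D\<^esub> b' = Id D B'"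
    using target.isomorphismE[OF b(2,1)] .
  have A': "A' \<in> Ob C" using source.Hom_Ob a by metis
  note Fa = on_Arr_Hom[OF a(1)] and Fa' = on_Arr_Hom[OF a'(1)]
  have aa: "on_Arr F a \<cdot>\<^bsub>D\<^esub> on_Arr F a' = Id D (on_Ob F A')"
    using on_Arr_Comp[OF a'(1) a(1)] a'(3) on_Arr_Id[OF A'] by simp
  have "b \<cdot>\<^bsub>D\<^esub> (f \<cdot>\<^bsub>D\<^esub> on_Arr F a') = (f' \<cdot>\<^bsub>D\<^esub> on_Arr F a) \<cdot>\<^bsub>D\<^esub> on_Arr F a'"
    using target.Comp_assoc[OF Fa' f b(1)] eq by simp
  also have "\<dots> = (b \<cdot>\<^bsub>D\<^esub> b') \<cdot>\<^bsub>D\<^esub> f'"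
    using target.Comp_assoc[OF Fa' Fa f'] aa target.Comp_Id[OF f'] b'(3) target.Id_Comp[OF f'] by simp
  also have "\<dots> = b \<cdot>\<^bsub>D\<^esub> (b' \<cdot>\<^bsub>D\<^esub> f')"
    using target.Comp_assoc[OF f' b'(1) b(1)] by simp
  finally have "f \<cdot>\<^bsub>D\<^esub> on_Arr F a' = b' \<cdot>\<^bsub>D\<^esub> f'"
    using target.isomorphism_cancel_left[OF b(2,1) target.Comp_Hom[OF Fa' f] target.Comp_Hom[OF f' b'(1)]]
    by simp
  then show ?thesis
    using comma.isomorphismI[OF comma_HomI[OF f f' a(1) b(1) eq] comma_HomI[OF f' f a'(1) b'(1)]] a' b'
    by simp
qed

end

section \<open>Recollements\<close>

text \<open>Units and counits are parameters, since the gluing functor is built from a fixed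
  \<open>\<phi>\<close>; the relation that \<open>j\<close> annihilates the image of
  \<open>i\<close> enters objectwise as \<open>ji_zero\<close>.\<close>

locale recollement_functors =
  T': triangulated_category T' + T: triangulated_category T + T'': triangulated_category T'' +
  i: additive_functor T' T i + ir: additive_functor T T' i\<^sub>r + j: additive_functor T T'' j +
  jl: additive_functor T'' T j\<^sub>l + jr: additive_functor T'' T j\<^sub>r +
  iir: adjunction T' T i i\<^sub>r \<epsilon>' \<epsilon> +
  jlj: adjunction T'' T j\<^sub>l j \<phi>' \<phi> +
  jjr: adjunction T T'' j j\<^sub>r \<eta> \<eta>'
  for T' :: "('o1, 'm1, 'x1) tri_cat_scheme" and T :: "('o, 'm, 'x) tri_cat_scheme"
    and T'' :: "('o2, 'm2, 'x2) tri_cat_scheme"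
    and i i\<^sub>r j j\<^sub>l j\<^sub>r \<epsilon>' \<epsilon> \<phi>' \<phi> \<eta> \<eta>' +
  assumes triangle_functor_ir: "triangle_functor T T' i\<^sub>r"
    and triangle_functor_j: "triangle_functor T T'' j"
    and fully_faithful_i: "fully_faithful T' T i"
    and fully_faithful_jl: "fully_faithful T'' T j\<^sub>l"
    and fully_faithful_jr: "fully_faithful T'' T j\<^sub>r"
    and ji_zero: "A \<in> Ob T' \<Longrightarrow> zero_object T'' (on_Ob j (on_Ob i A))"
    and exact_counit_unit: "X \<in> Ob T \<Longrightarrow> \<exists>\<delta>. exact_triangle T (on_Ob i (on_Ob i\<^sub>r X)) X
      (on_Ob j\<^sub>r (on_Ob j X)) (\<epsilon> X) (\<eta> X) \<delta>"
begin

section \<open>Vanishing and invertibility in a recollement\<close>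

text \<open>Maps from \<open>i K\<close> to \<open>j\<^sub>r A\<close> correspond to maps from the
  zero object \<open>j (i K)\<close> to \<open>A\<close>, so any two agree. With
  \<open>K = i\<^sub>r (j\<^sub>r A)\<close>, the identity and the zero map of \<open>K\<close> thus
  have equal transposes.\<close>

lemma ir_jr_zero:
  assumes A: "A \<in> Ob T''"
  shows "zero_object T' (on_Ob i\<^sub>r (on_Ob j\<^sub>r A))"
proof -
  let ?J = "on_Ob j\<^sub>r A" and ?K = "on_Ob i\<^sub>r (on_Ob j\<^sub>r A)"
  have J: "?J \<in> Ob T" using jr.on_Ob_Ob[OF A] .
  have K: "?K \<in> Ob T'" using ir.on_Ob_Ob[OF J] .
  have iK: "on_Ob i ?K \<in> Ob T" using i.on_Ob_Ob[OF K] .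
  note I = T'.Id_Hom[OF K] and Z = T'.Zero_Hom[OF K K]
  note p = T.Comp_Hom[OF i.on_Arr_Hom[OF I] iir.counit_Hom[OF J]]
  note q = T.Comp_Hom[OF i.on_Arr_Hom[OF Z] iir.counit_Hom[OF J]]
  have "on_Arr j (\<epsilon> ?J \<cdot>\<^bsub>T\<^esub> on_Arr i (Id T' ?K)) = on_Arr j (\<epsilon> ?J \<cdot>\<^bsub>T\<^esub> on_Arr i (Zero T' ?K ?K))"
    using T''.zero_object_from[OF ji_zero[OF K] j.on_Arr_Hom[OF p]]
      T''.zero_object_from[OF ji_zero[OF K] j.on_Arr_Hom[OF q]] by simp
  then have "\<epsilon> ?J \<cdot>\<^bsub>T\<^esub> on_Arr i (Id T' ?K) = \<epsilon> ?J \<cdot>\<^bsub>T\<^esub> on_Arr i (Zero T' ?K ?K)"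
    using jjr.transpose_inj[OF iK A p q] by simp
  then show ?thesis
    using iir.transpose_inj[OF K J I Z] T'.zero_object_iff K by simp
qed

text \<open>By a triangle identity, the counit at \<open>j X\<close> is a left inverse of this map;
  it is invertible because \<open>j\<^sub>r\<close> is fully faithful.\<close>

lemma j_unit_isomorphism:
  assumes X: "X \<in> Ob T"
  shows "isomorphism T'' (on_Arr j (\<eta> X))"
proof -
  have jX: "on_Ob j X \<in> Ob T''" using j.on_Ob_Ob[OF X] .
  note e = jjr.counit_Hom[OF jX] and e_iso = jjr.counit_isomorphism[OF fully_faithful_jr jX]
  have I: "isomorphism T'' (Id T'' (on_Ob j X))"
    using T''.isomorphismI[OF T''.Id_Hom[OF jX] T''.Id_Hom[OF jX]] T''.Comp_Id[OF T''.Id_Hom[OF jX]]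
    by simp
  show ?thesis
    using T''.isomorphism_Comp_cancel_left[OF j.on_Arr_Hom[OF jjr.unit_Hom[OF X]] e e_iso]
      jjr.triangle_left[OF X] I by simp
qed

text \<open>By a triangle identity, this map is a left inverse of the unit at \<open>j X\<close>,
  which is invertible because \<open>j\<^sub>l\<close> is fully faithful.\<close>

lemma j_counit_isomorphism:
  assumes X: "X \<in> Ob T"
  shows "isomorphism T'' (on_Arr j (\<phi> X))"
proof -
  have jX: "on_Ob j X \<in> Ob T''" using j.on_Ob_Ob[OF X] .
  note u = jlj.unit_Hom[OF jX] and u_iso = jlj.unit_isomorphism[OF fully_faithful_jl jX]
  note jp = j.on_Arr_Hom[OF jlj.counit_Hom[OF X]]
  obtain v where v: "v \<in> Hom T'' (on_Ob j (on_Ob j\<^sub>l (on_Ob j X))) (on_Ob j X)"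
    "v \<cdot>\<^bsub>T''\<^esub> \<phi>' (on_Ob j X) = Id T'' (on_Ob j X)"
    "\<phi>' (on_Ob j X) \<cdot>\<^bsub>T''\<^esub> v = Id T'' (on_Ob j (on_Ob j\<^sub>l (on_Ob j X)))"
    using T''.isomorphismE[OF u_iso u] .
  have "on_Arr j (\<phi> X) = v"
    using T''.isomorphism_cancel_right[OF u_iso u jp v(1)] jlj.triangle_right[OF X] v(2) by simp
  then show ?thesis using T''.isomorphismI[OF v(1) u v(3,2)] by simp
qed

section \<open>Lifting maps and endomorphisms with trivial images\<close>

text \<open>The triangles \<open>i i\<^sub>\<rho> X \<rightarrow> X \<rightarrow> j\<^sub>\<rho> j X \<rightarrow>\<close> are functorial: the filler provided by TR3 is
  forced to be \<open>j\<^sub>\<rho> j h\<close>.\<close>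

lemma connecting_natural:
  assumes h: "h \<in> Hom T X Y"
    and eX: "exact_triangle T (on_Ob i (on_Ob i\<^sub>r X)) X (on_Ob j\<^sub>r (on_Ob j X)) (\<epsilon> X) (\<eta> X) \<delta>"
    and eY: "exact_triangle T (on_Ob i (on_Ob i\<^sub>r Y)) Y (on_Ob j\<^sub>r (on_Ob j Y)) (\<epsilon> Y) (\<eta> Y) \<delta>'"
  shows "on_Arr (Susp T) (on_Arr i (on_Arr i\<^sub>r h)) \<cdot>\<^bsub>T\<^esub> \<delta> = \<delta>' \<cdot>\<^bsub>T\<^esub> on_Arr j\<^sub>r (on_Arr j h)"
proof -
  have X: "X \<in> Ob T" and Y: "Y \<in> Ob T" using T.Hom_Ob h by metis+
  have jX: "on_Ob j X \<in> Ob T''" and jY: "on_Ob j Y \<in> Ob T''" using j.on_Ob_Ob X Y by auto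
  have J: "on_Ob j\<^sub>r (on_Ob j X) \<in> Ob T" using jr.on_Ob_Ob[OF jX] .
  obtain c where c: "c \<in> Hom T (on_Ob j\<^sub>r (on_Ob j X)) (on_Ob j\<^sub>r (on_Ob j Y))"
    "c \<cdot>\<^bsub>T\<^esub> \<eta> X = \<eta> Y \<cdot>\<^bsub>T\<^esub> h"
    "on_Arr (Susp T) (on_Arr i (on_Arr i\<^sub>r h)) \<cdot>\<^bsub>T\<^esub> \<delta> = \<delta>' \<cdot>\<^bsub>T\<^esub> c"
    using T.TR3[OF eX eY i.on_Arr_Hom[OF ir.on_Arr_Hom[OF h]] h iir.counit_natural[OF h, symmetric]]
    by metis
  note d = jr.on_Arr_Hom[OF j.on_Arr_Hom[OF h]] and u = jjr.unit_Hom[OF X]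
  \<comment> \<open>Invertibility of \<open>j (\<eta> X)\<close> fixes \<open>j c\<close>; since
    \<open>c\<close> ends in an object \<open>j\<^sub>r (j Y)\<close>, its transpose, and hence
    \<open>c\<close>, is determined by \<open>j c\<close>.\<close>
  have "on_Arr j (c \<cdot>\<^bsub>T\<^esub> \<eta> X) = on_Arr j (on_Arr j\<^sub>r (on_Arr j h) \<cdot>\<^bsub>T\<^esub> \<eta> X)"
    using c(2) jjr.unit_natural[OF h] by simp
  then have "on_Arr j c \<cdot>\<^bsub>T''\<^esub> on_Arr j (\<eta> X)
      = on_Arr j (on_Arr j\<^sub>r (on_Arr j h)) \<cdot>\<^bsub>T''\<^esub> on_Arr j (\<eta> X)"
    using j.on_Arr_Comp[OF u c(1)] j.on_Arr_Comp[OF u d] by simp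
  then have "on_Arr j c = on_Arr j (on_Arr j\<^sub>r (on_Arr j h))"
    using T''.isomorphism_cancel_right[OF j_unit_isomorphism[OF X] j.on_Arr_Hom[OF u]
        j.on_Arr_Hom[OF c(1)] j.on_Arr_Hom[OF d]] by simp
  then have "c = on_Arr j\<^sub>r (on_Arr j h)"
    using jjr.transpose_inj[OF J jY c(1) d] by simp
  then show ?thesis using c(3) by simp
qed

text \<open>Two stages: extend \<open>q\<close> along \<open>\<epsilon> X\<close> to a map
  \<open>h0\<close>, then correct \<open>h0\<close> by a map \<open>t\<close> that vanishes on
  \<open>\<epsilon> X\<close> and repairs the restriction along \<open>\<phi> X\<close>.\<close>

lemma weak_pushout:
  assumes X: "X \<in> Ob T"
    and p: "p \<in> Hom T (on_Ob j\<^sub>l (on_Ob j X)) Y" and q: "q \<in> Hom T (on_Ob i (on_Ob i\<^sub>r X)) Y"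
    and eq: "p \<cdot>\<^bsub>T\<^esub> \<epsilon> (on_Ob j\<^sub>l (on_Ob j X)) = q \<cdot>\<^bsub>T\<^esub> on_Arr i (on_Arr i\<^sub>r (\<phi> X))"
  obtains h where "h \<in> Hom T X Y" "h \<cdot>\<^bsub>T\<^esub> \<phi> X = p" "h \<cdot>\<^bsub>T\<^esub> \<epsilon> X = q"
proof -
  let ?N = "on_Ob j\<^sub>l (on_Ob j X)"
  let ?m = "on_Arr i (on_Arr i\<^sub>r (\<phi> X))" and ?k = "on_Arr j\<^sub>r (on_Arr j (\<phi> X))"
  let ?S = "on_Arr (Susp T)"
  have Y: "Y \<in> Ob T" and N: "?N \<in> Ob T" using T.Hom_Ob p by metis+
  note f = jlj.counit_Hom[OF X]
  note m = i.on_Arr_Hom[OF ir.on_Arr_Hom[OF f]] and k = jr.on_Arr_Hom[OF j.on_Arr_Hom[OF f]]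
  obtain \<delta> where eX: "exact_triangle T (on_Ob i (on_Ob i\<^sub>r X)) X (on_Ob j\<^sub>r (on_Ob j X)) (\<epsilon> X) (\<eta> X) \<delta>"
    using exact_counit_unit[OF X] by auto
  obtain \<gamma> where eN: "exact_triangle T (on_Ob i (on_Ob i\<^sub>r ?N)) ?N (on_Ob j\<^sub>r (on_Ob j ?N))
      (\<epsilon> ?N) (\<eta> ?N) \<gamma>"
    using exact_counit_unit[OF N] by auto
  note HX = T.exact_triangle_Hom[OF eX] and HN = T.exact_triangle_Hom[OF eN]
  have k_iso: "isomorphism T ?k"
    using jr.isomorphism_on_Arr[OF j_counit_isomorphism[OF X]] .
  obtain k' where k': "k' \<in> Hom T (on_Ob j\<^sub>r (on_Ob j X)) (on_Ob j\<^sub>r (on_Ob j ?N))"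
    "k' \<cdot>\<^bsub>T\<^esub> ?k = Id T (on_Ob j\<^sub>r (on_Ob j ?N))" "?k \<cdot>\<^bsub>T\<^esub> k' = Id T (on_Ob j\<^sub>r (on_Ob j X))"
    using T.isomorphismE[OF k_iso k] .
  note Sq = T.Susp.on_Arr_Hom[OF q] and Sm = T.Susp.on_Arr_Hom[OF m] and Sp = T.Susp.on_Arr_Hom[OF p]
  note Se = T.Susp.on_Arr_Hom[OF HN(1)]
  have SY: "on_Ob (Susp T) Y \<in> Ob T" using T.Susp.on_Ob_Ob[OF Y] .
  have J: "on_Ob j\<^sub>r (on_Ob j ?N) \<in> Ob T" "on_Ob j\<^sub>r (on_Ob j X) \<in> Ob T" using T.Hom_Ob k by metis+
  have Se0: "?S (\<epsilon> ?N) \<cdot>\<^bsub>T\<^esub> \<gamma> = Zero T (on_Ob j\<^sub>r (on_Ob j ?N)) (on_Ob (Susp T) ?N)"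
  proof -
    have "Minus T (?S (\<epsilon> ?N) \<cdot>\<^bsub>T\<^esub> \<gamma>) = Zero T (on_Ob j\<^sub>r (on_Ob j ?N)) (on_Ob (Susp T) ?N)"
      using T.exact_triangle_Comp_Zero[OF T.exact_triangle_rotate[OF T.exact_triangle_rotate[OF eN]]]
        T.Minus_Comp[OF HN(3) Se] by simp
    then show ?thesis
      using T.Minus_Minus[OF T.Comp_Hom[OF HN(3) Se]] T.Minus_Zero[OF J(1) T.Susp.on_Ob_Ob[OF N]]
      by simp
  qed
  \<comment> \<open>The obstruction to extending \<open>q\<close> is tested after the isomorphism
    \<open>?k\<close>: there naturality of the connecting maps and \<open>eq\<close> rewrite it
    through two consecutive maps of the rotated triangle of \<open>?N\<close>.\<close>
  have "(?S q \<cdot>\<^bsub>T\<^esub> \<delta>) \<cdot>\<^bsub>T\<^esub> ?k = ?S q \<cdot>\<^bsub>T\<^esub> (?S ?m \<cdot>\<^bsub>T\<^esub> \<gamma>)"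
    using T.Comp_assoc[OF k HX(3) Sq] connecting_natural[OF f eN eX] by simp
  also have "\<dots> = ?S (q \<cdot>\<^bsub>T\<^esub> ?m) \<cdot>\<^bsub>T\<^esub> \<gamma>"
    using T.Comp_assoc[OF HN(3) Sm Sq] T.Susp.on_Arr_Comp[OF m q] by simp
  also have "\<dots> = ?S p \<cdot>\<^bsub>T\<^esub> (?S (\<epsilon> ?N) \<cdot>\<^bsub>T\<^esub> \<gamma>)"
    using T.Comp_assoc[OF HN(3) Se Sp] T.Susp.on_Arr_Comp[OF HN(1) p] eq by simp
  also have "\<dots> = Zero T (on_Ob j\<^sub>r (on_Ob j X)) (on_Ob (Susp T) Y) \<cdot>\<^bsub>T\<^esub> ?k"
    using Se0 T.Comp_Zero[OF Sp J(1)] T.Zero_Comp[OF k SY] by simp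
  finally have "?S q \<cdot>\<^bsub>T\<^esub> \<delta> = Zero T (on_Ob j\<^sub>r (on_Ob j X)) (on_Ob (Susp T) Y)"
    using T.isomorphism_cancel_right[OF k_iso k T.Comp_Hom[OF HX(3) Sq] T.Zero_Hom[OF J(2) SY]]
    by simp
  then obtain h0 where h0: "h0 \<in> Hom T X Y" "h0 \<cdot>\<^bsub>T\<^esub> \<epsilon> X = q"
    using T.exact_triangle_extend[OF eX q] by metis
  note h0f = T.Comp_Hom[OF f h0(1)]
  note mh0f = T.Minus_Hom[OF h0f]
  \<comment> \<open>The error of \<open>h0\<close> on \<open>?N\<close>; it vanishes on
    \<open>\<epsilon> ?N\<close> and so factors through \<open>\<eta> ?N\<close>.\<close>
  let ?d = "p \<oplus>\<^bsub>T\<^esub> Minus T (h0 \<cdot>\<^bsub>T\<^esub> \<phi> X)"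
  note d = T.Plus_Hom[OF p mh0f]
  have "(h0 \<cdot>\<^bsub>T\<^esub> \<phi> X) \<cdot>\<^bsub>T\<^esub> \<epsilon> ?N = h0 \<cdot>\<^bsub>T\<^esub> (\<epsilon> X \<cdot>\<^bsub>T\<^esub> ?m)"
    using T.Comp_assoc[OF HN(1) f h0(1)] iir.counit_natural[OF f] by simp
  also have "\<dots> = p \<cdot>\<^bsub>T\<^esub> \<epsilon> ?N"
    using T.Comp_assoc[OF m HX(1) h0(1)] h0(2) eq by simp
  finally have "?d \<cdot>\<^bsub>T\<^esub> \<epsilon> ?N = p \<cdot>\<^bsub>T\<^esub> \<epsilon> ?N \<oplus>\<^bsub>T\<^esub> Minus T (p \<cdot>\<^bsub>T\<^esub> \<epsilon> ?N)"
    using T.Plus_Comp[OF HN(1) p mh0f] T.Minus_Comp[OF HN(1) h0f] by simp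
  then have "?d \<cdot>\<^bsub>T\<^esub> \<epsilon> ?N = Zero T (on_Ob i (on_Ob i\<^sub>r ?N)) Y"
    using T.Plus_Minus[OF T.Comp_Hom[OF HN(1) p]] by simp
  then obtain s where s: "s \<in> Hom T (on_Ob j\<^sub>r (on_Ob j ?N)) Y" "s \<cdot>\<^bsub>T\<^esub> \<eta> ?N = ?d"
    using T.exact_triangle_weak_cokernel[OF eN d] by metis
  note sk = T.Comp_Hom[OF k'(1) s(1)]
  \<comment> \<open>Inverting \<open>?k\<close> transports the factorization of the error to
    \<open>X\<close>; naturality of \<open>\<eta>\<close> gives
    \<open>t \<cdot> \<phi> X = ?d\<close>.\<close>
  define t where "t = (s \<cdot>\<^bsub>T\<^esub> k') \<cdot>\<^bsub>T\<^esub> \<eta> X"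
  have t: "t \<in> Hom T X Y" unfolding t_def using T.Comp_Hom[OF HX(2) sk] .
  have "t \<cdot>\<^bsub>T\<^esub> \<epsilon> X = Zero T (on_Ob i (on_Ob i\<^sub>r X)) Y"
    unfolding t_def
    using T.Comp_assoc[OF HX(1,2) sk] T.exact_triangle_Comp_Zero[OF eX]
      T.Comp_Zero[OF sk] T.Hom_Ob[OF HX(1)] by simp
  then have te: "(h0 \<oplus>\<^bsub>T\<^esub> t) \<cdot>\<^bsub>T\<^esub> \<epsilon> X = q"
    using T.Plus_Comp[OF HX(1) h0(1) t] h0(2) T.Plus_Zero[OF q] by simp
  have "t \<cdot>\<^bsub>T\<^esub> \<phi> X = (s \<cdot>\<^bsub>T\<^esub> k') \<cdot>\<^bsub>T\<^esub> (?k \<cdot>\<^bsub>T\<^esub> \<eta> ?N)"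
    unfolding t_def
    using T.Comp_assoc[OF f HX(2) sk] jjr.unit_natural[OF f] by simp
  also have "\<dots> = (s \<cdot>\<^bsub>T\<^esub> (k' \<cdot>\<^bsub>T\<^esub> ?k)) \<cdot>\<^bsub>T\<^esub> \<eta> ?N"
    using T.Comp_assoc[OF HN(2) k sk] T.Comp_assoc[OF k k'(1) s(1)] by simp
  also have "\<dots> = ?d"
    using k'(2) T.Comp_Id[OF s(1)] s(2) by simp
  finally have "(h0 \<oplus>\<^bsub>T\<^esub> t) \<cdot>\<^bsub>T\<^esub> \<phi> X = p"
    using T.Plus_Comp[OF f h0(1) t] T.Plus_Minus_cancel[OF h0f p] by simp
  then show thesis using that[OF T.Plus_Hom[OF h0(1) t] _ te] by simp
qed

lemma isomorphism_of_trivial_images: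
  assumes e: "e \<in> Hom T X X" and je: "on_Arr j e = Id T'' (on_Ob j X)"
    and ire: "on_Arr i\<^sub>r e = Id T' (on_Ob i\<^sub>r X)"
  shows "isomorphism T e"
proof -
  have X: "X \<in> Ob T" using T.Hom_Ob e by metis
  note I = T.Id_Hom[OF X] and mI = T.Minus_Hom[OF T.Id_Hom[OF X]]
  \<comment> \<open>From \<open>i\<^sub>r n = 0\<close> follows
    \<open>n \<cdot> \<epsilon> X = 0\<close>, hence \<open>n = s \<cdot> \<eta> X\<close>; from
    \<open>j n = 0\<close> follows \<open>\<eta> X \<cdot> n = 0\<close>. Together they give
    \<open>n \<cdot> n = 0\<close>.\<close>
  define n where "n = e \<oplus>\<^bsub>T\<^esub> Minus T (Id T X)"
  have n: "n \<in> Hom T X X" unfolding n_def using T.Plus_Hom[OF e mI] .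
  have jX: "on_Ob j X \<in> Ob T''" and iX: "on_Ob i\<^sub>r X \<in> Ob T'" using j.on_Ob_Ob ir.on_Ob_Ob X by auto
  have jn: "on_Arr j n = Zero T'' (on_Ob j X) (on_Ob j X)"
    unfolding n_def using j.on_Arr_Plus[OF e mI] j.on_Arr_Minus[OF I] j.on_Arr_Id[OF X] je
      T''.Plus_Minus[OF T''.Id_Hom[OF jX]] by simp
  have irn: "on_Arr i\<^sub>r n = Zero T' (on_Ob i\<^sub>r X) (on_Ob i\<^sub>r X)"
    unfolding n_def using ir.on_Arr_Plus[OF e mI] ir.on_Arr_Minus[OF I] ir.on_Arr_Id[OF X] ire
      T'.Plus_Minus[OF T'.Id_Hom[OF iX]] by simp
  obtain \<delta> where eX: "exact_triangle T (on_Ob i (on_Ob i\<^sub>r X)) X (on_Ob j\<^sub>r (on_Ob j X)) (\<epsilon> X) (\<eta> X) \<delta>"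
    using exact_counit_unit[OF X] by auto
  note H = T.exact_triangle_Hom[OF eX]
  have "n \<cdot>\<^bsub>T\<^esub> \<epsilon> X = Zero T (on_Ob i (on_Ob i\<^sub>r X)) X"
    using iir.counit_natural[OF n] irn i.on_Arr_Zero[OF iX iX] T.Comp_Zero[OF H(1)] T.Hom_Ob[OF H(1)]
    by simp
  then obtain s where s: "s \<in> Hom T (on_Ob j\<^sub>r (on_Ob j X)) X" "s \<cdot>\<^bsub>T\<^esub> \<eta> X = n"
    using T.exact_triangle_weak_cokernel[OF eX n] by metis
  have "\<eta> X \<cdot>\<^bsub>T\<^esub> n = Zero T X (on_Ob j\<^sub>r (on_Ob j X))"
    using jjr.unit_natural[OF n] jn jr.on_Arr_Zero[OF jX jX] T.Zero_Comp[OF H(2)] T.Hom_Ob[OF H(2)]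
    by simp
  then have "n \<cdot>\<^bsub>T\<^esub> n = Zero T X X"
    using T.Comp_assoc[OF n H(2) s(1)] s(2) T.Comp_Zero[OF s(1) X] by simp
  then have "isomorphism T (Id T X \<oplus>\<^bsub>T\<^esub> n)" using T.isomorphism_unipotent[OF n] by simp
  then show ?thesis unfolding n_def using T.Plus_Minus_cancel[OF I e] by simp
qed

section \<open>Objects with a prescribed gluing datum\<close>

text \<open>The witness is the cocone of \<open>\<Sigma>(i f) \<circ> \<delta> : j\<^sub>\<rho> j j\<^sub>\<lambda> A \<rightarrow> \<Sigma> i B\<close>, a homotopy pushout of
  \<open>\<epsilon> : i i\<^sub>\<rho> j\<^sub>\<lambda> A \<rightarrow> j\<^sub>\<lambda> A\<close> along \<open>i f\<close>.\<close>

lemma ex_gluing: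
  assumes A: "A \<in> Ob T''" and B: "B \<in> Ob T'" and f: "f \<in> Hom T' (on_Ob i\<^sub>r (on_Ob j\<^sub>l A)) B"
  obtains X a b where "X \<in> Ob T" "a \<in> Hom T'' A (on_Ob j X)" "isomorphism T'' a"
    "b \<in> Hom T' B (on_Ob i\<^sub>r X)" "isomorphism T' b"
    "on_Arr i\<^sub>r (\<phi> X) \<cdot>\<^bsub>T'\<^esub> on_Arr i\<^sub>r (on_Arr j\<^sub>l a) = b \<cdot>\<^bsub>T'\<^esub> f"
proof -
  let ?N = "on_Ob j\<^sub>l A"
  let ?J = "on_Ob j\<^sub>r (on_Ob j ?N)" and ?P = "on_Ob i B"
  have N: "?N \<in> Ob T" using jl.on_Ob_Ob[OF A] .
  have P: "?P \<in> Ob T" using i.on_Ob_Ob[OF B] .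
  have jN: "on_Ob j ?N \<in> Ob T''" using j.on_Ob_Ob[OF N] .
  have irN: "on_Ob i\<^sub>r ?N \<in> Ob T'" using ir.on_Ob_Ob[OF N] .
  have J: "?J \<in> Ob T" using jr.on_Ob_Ob[OF jN] .
  obtain \<delta> where eN: "exact_triangle T (on_Ob i (on_Ob i\<^sub>r ?N)) ?N ?J (\<epsilon> ?N) (\<eta> ?N) \<delta>"
    using exact_counit_unit[OF N] by auto
  note HN = T.exact_triangle_Hom[OF eN]
  note fi = i.on_Arr_Hom[OF f]
  note w = T.Comp_Hom[OF HN(3) T.Susp.on_Arr_Hom[OF fi]]
  obtain X u v where eX: "exact_triangle T ?P X ?J u v (on_Arr (Susp T) (on_Arr i f) \<cdot>\<^bsub>T\<^esub> \<delta>)"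
    using T.exact_triangle_complete_right[OF w P] .
  note HX = T.exact_triangle_Hom[OF eX]
  have X: "X \<in> Ob T" using T.Hom_Ob HX by metis
  \<comment> \<open>The third map of \<open>eX\<close> was chosen so that the identity of
    \<open>?J\<close> and \<open>i f\<close> are compatible with the connecting maps;
    \<open>g\<close> fills in the middle.\<close>
  obtain g where g: "g \<in> Hom T ?N X" "g \<cdot>\<^bsub>T\<^esub> \<epsilon> ?N = u \<cdot>\<^bsub>T\<^esub> on_Arr i f"
    "Id T ?J \<cdot>\<^bsub>T\<^esub> \<eta> ?N = v \<cdot>\<^bsub>T\<^esub> g"
    using T.TR3_middle[OF eN eX fi T.Id_Hom[OF J]] T.Comp_Id[OF w] by metis
  obtain z where "exact_triangle T'' (on_Ob j ?P) (on_Ob j X) (on_Ob j ?J) (on_Arr j u) (on_Arr j v) z"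
    using triangle_functor_exact[OF triangle_functor_j eX] .
  \<comment> \<open>\<open>j\<close> kills \<open>i B\<close>, the first term. As
    \<open>v \<cdot> g = \<eta> ?N\<close> and \<open>j\<close> inverts this unit, it also inverts
    \<open>g\<close>.\<close>
  then have jv: "isomorphism T'' (on_Arr j v)"
    using T''.exact_triangle_isomorphism_middle ji_zero[OF B] by metis
  have jg: "isomorphism T'' (on_Arr j g)"
    using T''.isomorphism_Comp_cancel_left[OF j.on_Arr_Hom[OF g(1)] j.on_Arr_Hom[OF HX(2)] jv]
      j_unit_isomorphism[OF N] g(3) T.Id_Comp[OF HN(2)] j.on_Arr_Comp[OF g(1) HX(2)] by simp
  obtain y where "exact_triangle T' (on_Ob i\<^sub>r ?P) (on_Ob i\<^sub>r X) (on_Ob i\<^sub>r ?J)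
      (on_Arr i\<^sub>r u) (on_Arr i\<^sub>r v) y"
    using triangle_functor_exact[OF triangle_functor_ir eX] .
  \<comment> \<open>\<open>i\<^sub>r\<close> kills the third term, which lies in the image of
    \<open>j\<^sub>r\<close>.\<close>
  then have iru: "isomorphism T' (on_Arr i\<^sub>r u)"
    using T'.exact_triangle_isomorphism_left ir_jr_zero[OF jN] by metis
  \<comment> \<open>The transposes of \<open>g\<close> and \<open>u\<close> under the adjunctions
    \<open>(j\<^sub>l, j)\<close> and \<open>(i, i\<^sub>r)\<close>. Both legs of the required
    square turn out to be \<open>i\<^sub>r g\<close>.\<close>
  let ?a = "on_Arr j g \<cdot>\<^bsub>T''\<^esub> \<phi>' A" and ?b = "on_Arr i\<^sub>r u \<cdot>\<^bsub>T'\<^esub> \<epsilon>' B"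
  note p = jlj.unit_Hom[OF A] and e = iir.unit_Hom[OF B]
  note jgH = j.on_Arr_Hom[OF g(1)] and iruH = ir.on_Arr_Hom[OF HX(1)] and irgH = ir.on_Arr_Hom[OF g(1)]
  note a = T''.Comp_Hom[OF p jgH] and b = T'.Comp_Hom[OF e iruH]
  have a_iso: "isomorphism T'' ?a"
    using T''.isomorphism_Comp[OF p jlj.unit_isomorphism[OF fully_faithful_jl A] jgH jg] .
  have b_iso: "isomorphism T' ?b"
    using T'.isomorphism_Comp[OF e iir.unit_isomorphism[OF fully_faithful_i B] iruH iru] .
  have "\<phi> X \<cdot>\<^bsub>T\<^esub> on_Arr j\<^sub>l ?a = (\<phi> X \<cdot>\<^bsub>T\<^esub> on_Arr j\<^sub>l (on_Arr j g)) \<cdot>\<^bsub>T\<^esub> on_Arr j\<^sub>l (\<phi>' A)"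
    using jl.on_Arr_Comp[OF p jgH]
      T.Comp_assoc[OF jl.on_Arr_Hom[OF p] jl.on_Arr_Hom[OF jgH] jlj.counit_Hom[OF X]] by simp
  also have "\<dots> = g \<cdot>\<^bsub>T\<^esub> (\<phi> ?N \<cdot>\<^bsub>T\<^esub> on_Arr j\<^sub>l (\<phi>' A))"
    using jlj.counit_natural[OF g(1)]
      T.Comp_assoc[OF jl.on_Arr_Hom[OF p] jlj.counit_Hom[OF N] g(1)] by simp
  also have "\<dots> = g"
    using jlj.triangle_left[OF A] T.Comp_Id[OF g(1)] by simp
  finally have left: "on_Arr i\<^sub>r (\<phi> X) \<cdot>\<^bsub>T'\<^esub> on_Arr i\<^sub>r (on_Arr j\<^sub>l ?a) = on_Arr i\<^sub>r g"
    using ir.on_Arr_Comp[OF jl.on_Arr_Hom[OF a] jlj.counit_Hom[OF X]] by simp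
  note n = iir.unit_Hom[OF irN] and irf = ir.on_Arr_Hom[OF fi] and ire = ir.on_Arr_Hom[OF HN(1)]
  have "?b \<cdot>\<^bsub>T'\<^esub> f = on_Arr i\<^sub>r u \<cdot>\<^bsub>T'\<^esub> (on_Arr i\<^sub>r (on_Arr i f) \<cdot>\<^bsub>T'\<^esub> \<epsilon>' (on_Ob i\<^sub>r ?N))"
    using T'.Comp_assoc[OF f e iruH] iir.unit_natural[OF f] by simp
  also have "\<dots> = on_Arr i\<^sub>r (g \<cdot>\<^bsub>T\<^esub> \<epsilon> ?N) \<cdot>\<^bsub>T'\<^esub> \<epsilon>' (on_Ob i\<^sub>r ?N)"
    using T'.Comp_assoc[OF n irf iruH] ir.on_Arr_Comp[OF fi HX(1)] g(2) by simp
  also have "\<dots> = on_Arr i\<^sub>r g \<cdot>\<^bsub>T'\<^esub> (on_Arr i\<^sub>r (\<epsilon> ?N) \<cdot>\<^bsub>T'\<^esub> \<epsilon>' (on_Ob i\<^sub>r ?N))"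
    using T'.Comp_assoc[OF n ire irgH] ir.on_Arr_Comp[OF HN(1) g(1)] by simp
  also have "\<dots> = on_Arr i\<^sub>r g"
    using iir.triangle_right[OF N] T'.Comp_Id[OF irgH] by simp
  finally show thesis using that[OF X a a_iso b b_iso] left by simp
qed

section \<open>The gluing functor and its epivalence properties\<close>

definition gluing_datum where
  "gluing_datum X = (on_Ob j X, on_Ob i\<^sub>r X, on_Arr i\<^sub>r (\<phi> X))"

text \<open>Arrows of the comma category carry their endpoints, so these are computed from
  \<open>Dom T\<close> and \<open>Cod T\<close>.\<close>

definition gluing_functor where
  "gluing_functor = \<lparr>on_Ob = gluing_datum,
    on_Arr = (\<lambda>f. (gluing_datum (Dom T f), gluing_datum (Cod T f), on_Arr j f, on_Arr i\<^sub>r f))\<rparr>"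

abbreviation gluing_category where
  "gluing_category \<equiv> comma T'' T' (i\<^sub>r \<circ>\<^sub>F j\<^sub>l)"

sublocale irjl: is_functor T'' T' "i\<^sub>r \<circ>\<^sub>F j\<^sub>l"
  using is_functor_comp_functor[OF jl.is_functor_axioms ir.is_functor_axioms] .

sublocale gluing: category gluing_category
  by (rule irjl.category_comma)

lemma on_Arr_gluing_functor:
  assumes "f \<in> Hom T X Y"
  shows "on_Arr gluing_functor f = (gluing_datum X, gluing_datum Y, on_Arr j f, on_Arr i\<^sub>r f)"
  using assms by (simp add: gluing_functor_def Hom_def)

lemma gluing_datum_Hom:
  assumes "X \<in> Ob T"
  shows "on_Arr i\<^sub>r (\<phi> X) \<in> Hom T' (on_Ob (i\<^sub>r \<circ>\<^sub>F j\<^sub>l) (on_Ob j X)) (on_Ob i\<^sub>r X)"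
  using ir.on_Arr_Hom[OF jlj.counit_Hom[OF assms]] by simp

text \<open>Applying \<open>i\<^sub>r\<close> to naturality of \<open>\<phi>\<close> yields the
  comma condition for \<open>(j f, i\<^sub>r f)\<close>.\<close>

lemma is_functor_gluing_functor: "is_functor T gluing_category gluing_functor"
proof unfold_locales
  show "on_Ob gluing_functor X \<in> Ob gluing_category" if "X \<in> Ob T" for X
    using gluing_datum_Hom[OF that] j.on_Ob_Ob[OF that] ir.on_Ob_Ob[OF that]
    by (simp add: gluing_functor_def gluing_datum_def comma_Ob_iff)
  show "on_Arr gluing_functor f \<in> Hom gluing_category (on_Ob gluing_functor X) (on_Ob gluing_functor Y)"
    if f: "f \<in> Hom T X Y" for f X Y
  proof -
    have X: "X \<in> Ob T" and Y: "Y \<in> Ob T" using T.Hom_Ob f by metis+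
    note jf = j.on_Arr_Hom[OF f] and irf = ir.on_Arr_Hom[OF f]
    have "on_Arr i\<^sub>r (\<phi> Y) \<cdot>\<^bsub>T'\<^esub> on_Arr (i\<^sub>r \<circ>\<^sub>F j\<^sub>l) (on_Arr j f) = on_Arr i\<^sub>r f \<cdot>\<^bsub>T'\<^esub> on_Arr i\<^sub>r (\<phi> X)"
      using ir.on_Arr_Comp[OF jl.on_Arr_Hom[OF jf] jlj.counit_Hom[OF Y]]
        ir.on_Arr_Comp[OF jlj.counit_Hom[OF X] f] jlj.counit_natural[OF f] by simp
    then show ?thesis
      using irjl.comma_HomI[OF gluing_datum_Hom[OF X] gluing_datum_Hom[OF Y] jf irf]
      unfolding on_Arr_gluing_functor[OF f] by (simp add: gluing_functor_def gluing_datum_def)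
  qed
  show "on_Arr gluing_functor (Id T X) = Id gluing_category (on_Ob gluing_functor X)"
    if "X \<in> Ob T" for X
    unfolding on_Arr_gluing_functor[OF T.Id_Hom[OF that]]
    by (simp add: gluing_functor_def gluing_datum_def j.on_Arr_Id[OF that] ir.on_Arr_Id[OF that])
  show "on_Arr gluing_functor (g \<cdot>\<^bsub>T\<^esub> f)
      = on_Arr gluing_functor g \<cdot>\<^bsub>gluing_category\<^esub> on_Arr gluing_functor f"
    if f: "f \<in> Hom T X Y" and g: "g \<in> Hom T Y Z" for f g X Y Z
    unfolding on_Arr_gluing_functor[OF f] on_Arr_gluing_functor[OF g]
      on_Arr_gluing_functor[OF T.Comp_Hom[OF f g]]
    by (simp add: j.on_Arr_Comp[OF f g] ir.on_Arr_Comp[OF f g])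
qed

text \<open>The components \<open>a\<close> and \<open>b\<close> transpose to
  \<open>\<phi> Y \<cdot> j\<^sub>l a\<close> and \<open>\<epsilon> Y \<cdot> i b\<close>. The comma
  condition makes these compatible in the sense of \<open>weak_pushout\<close>, which supplies the
  lift.\<close>

lemma full_gluing_functor: "full T gluing_category gluing_functor"
  unfolding full_def
proof (intro ballI)
  fix X Y g
  assume X: "X \<in> Ob T" and Y: "Y \<in> Ob T"
    and g: "g \<in> Hom gluing_category (on_Ob gluing_functor X) (on_Ob gluing_functor Y)"
  obtain a b where a: "a \<in> Hom T'' (on_Ob j X) (on_Ob j Y)" and b: "b \<in> Hom T' (on_Ob i\<^sub>r X) (on_Ob i\<^sub>r Y)"
    and g_eq: "g = (gluing_datum X, gluing_datum Y, a, b)"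
    and eq: "on_Arr i\<^sub>r (\<phi> Y) \<cdot>\<^bsub>T'\<^esub> on_Arr i\<^sub>r (on_Arr j\<^sub>l a) = b \<cdot>\<^bsub>T'\<^esub> on_Arr i\<^sub>r (\<phi> X)"
    using g by (auto simp: gluing_functor_def gluing_datum_def comma_Hom_iff)
  let ?N = "on_Ob j\<^sub>l (on_Ob j X)"
  have jX: "on_Ob j X \<in> Ob T''" and iX: "on_Ob i\<^sub>r X \<in> Ob T'" using j.on_Ob_Ob ir.on_Ob_Ob X by auto
  have N: "?N \<in> Ob T" using jl.on_Ob_Ob[OF jX] .
  note fX = jlj.counit_Hom[OF X] and fY = jlj.counit_Hom[OF Y]
  note ja = jl.on_Arr_Hom[OF a] and ib = i.on_Arr_Hom[OF b]
  note eY = iir.counit_Hom[OF Y] and eN = iir.counit_Hom[OF N]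
  note p = T.Comp_Hom[OF ja fY] and q = T.Comp_Hom[OF ib eY]
  note irf = ir.on_Arr_Hom[OF fX]
  have "(\<phi> Y \<cdot>\<^bsub>T\<^esub> on_Arr j\<^sub>l a) \<cdot>\<^bsub>T\<^esub> \<epsilon> ?N = \<epsilon> Y \<cdot>\<^bsub>T\<^esub> on_Arr i (b \<cdot>\<^bsub>T'\<^esub> on_Arr i\<^sub>r (\<phi> X))"
    using iir.counit_natural[OF p] ir.on_Arr_Comp[OF ja fY] eq by simp
  also have "\<dots> = (\<epsilon> Y \<cdot>\<^bsub>T\<^esub> on_Arr i b) \<cdot>\<^bsub>T\<^esub> on_Arr i (on_Arr i\<^sub>r (\<phi> X))"
    using i.on_Arr_Comp[OF irf b] T.Comp_assoc[OF i.on_Arr_Hom[OF irf] ib eY] by simp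
  finally obtain h where h: "h \<in> Hom T X Y" "h \<cdot>\<^bsub>T\<^esub> \<phi> X = \<phi> Y \<cdot>\<^bsub>T\<^esub> on_Arr j\<^sub>l a"
    "h \<cdot>\<^bsub>T\<^esub> \<epsilon> X = \<epsilon> Y \<cdot>\<^bsub>T\<^esub> on_Arr i b"
    using weak_pushout[OF X p q] by metis
  \<comment> \<open>By naturality of the counits, \<open>j h\<close> and \<open>i\<^sub>r h\<close>
    have the same transposes as \<open>a\<close> and \<open>b\<close>.\<close>
  have "on_Arr j h = a"
    using jlj.transpose_inj[OF jX Y j.on_Arr_Hom[OF h(1)] a] jlj.counit_natural[OF h(1)] h(2) by simp
  moreover have "on_Arr i\<^sub>r h = b"
    using iir.transpose_inj[OF iX Y ir.on_Arr_Hom[OF h(1)] b] iir.counit_natural[OF h(1)] h(3) by simp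
  ultimately have "on_Arr gluing_functor h = g"
    using on_Arr_gluing_functor[OF h(1)] g_eq by simp
  then show "\<exists>h \<in> Hom T X Y. on_Arr gluing_functor h = g" using h(1) by auto
qed

lemma dense_gluing_functor: "dense T gluing_category gluing_functor"
  unfolding dense_def
proof
  fix M assume "M \<in> Ob gluing_category"
  moreover obtain A B f where M: "M = (A, B, f)" by (cases M)
  ultimately have A: "A \<in> Ob T''" and B: "B \<in> Ob T'"
    and f: "f \<in> Hom T' (on_Ob (i\<^sub>r \<circ>\<^sub>F j\<^sub>l) A) B" by (simp_all add: comma_Ob_iff)
  have f': "f \<in> Hom T' (on_Ob i\<^sub>r (on_Ob j\<^sub>l A)) B" using f by simp
  obtain X a b where X: "X \<in> Ob T" and a: "a \<in> Hom T'' A (on_Ob j X)" "isomorphism T'' a"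
    and b: "b \<in> Hom T' B (on_Ob i\<^sub>r X)" "isomorphism T' b"
    and eq': "on_Arr i\<^sub>r (\<phi> X) \<cdot>\<^bsub>T'\<^esub> on_Arr i\<^sub>r (on_Arr j\<^sub>l a) = b \<cdot>\<^bsub>T'\<^esub> f"
    using ex_gluing[OF A B f'] .
  have eq: "on_Arr i\<^sub>r (\<phi> X) \<cdot>\<^bsub>T'\<^esub> on_Arr (i\<^sub>r \<circ>\<^sub>F j\<^sub>l) a = b \<cdot>\<^bsub>T'\<^esub> f"
    using eq' by simp
  \<comment> \<open>\<open>ex_gluing\<close> supplies the isomorphism in the direction opposite to
    the one in \<open>dense\<close>; it is reversed below.\<close>
  have "isomorphic gluing_category M (gluing_datum X)"
    unfolding isomorphic_def M gluing_datum_def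
    using irjl.comma_HomI[OF f gluing_datum_Hom[OF X] a(1) b(1) eq]
      irjl.comma_isomorphismI[OF f gluing_datum_Hom[OF X] a b eq] by blast
  then show "\<exists>X \<in> Ob T. isomorphic gluing_category (on_Ob gluing_functor X) M"
    using gluing.isomorphic_sym[of M "gluing_datum X"] X by (auto simp: gluing_functor_def)
qed

text \<open>Fullness lifts the inverse of the image of \<open>h\<close> to some \<open>k\<close>.
  The composites of \<open>h\<close> and \<open>k\<close> map to identities, which makes them
  isomorphisms, though not necessarily identities; this suffices by
  \<open>isomorphism_of_composites\<close>.\<close>

lemma detects_isomorphisms_gluing_functor:
  "detects_isomorphisms T gluing_category gluing_functor"
  unfolding detects_isomorphisms_def
proof (intro ballI impI)
  fix h assume "h \<in> Arr T" and iso: "isomorphism gluing_category (on_Arr gluing_functor h)"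
  then obtain X Y where h: "h \<in> Hom T X Y" by (auto simp: Hom_def)
  have X: "X \<in> Ob T" and Y: "Y \<in> Ob T" using T.Hom_Ob h by metis+
  interpret \<Phi>: is_functor T gluing_category gluing_functor by (rule is_functor_gluing_functor)
  obtain m where m: "m \<in> Hom gluing_category (on_Ob gluing_functor Y) (on_Ob gluing_functor X)"
    "m \<cdot>\<^bsub>gluing_category\<^esub> on_Arr gluing_functor h = Id gluing_category (on_Ob gluing_functor X)"
    "on_Arr gluing_functor h \<cdot>\<^bsub>gluing_category\<^esub> m = Id gluing_category (on_Ob gluing_functor Y)"
    using gluing.isomorphismE[OF iso \<Phi>.on_Arr_Hom[OF h]] .
  obtain k where k: "k \<in> Hom T Y X" "on_Arr gluing_functor k = m"
    using full_gluing_functor m(1) X Y unfolding full_def by metis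
  have trivial: "isomorphism T e"
    if "e \<in> Hom T Z Z" "Z \<in> Ob T" "on_Arr gluing_functor e = Id gluing_category (on_Ob gluing_functor Z)"
    for e Z
    using isomorphism_of_trivial_images[OF that(1)] that(3) on_Arr_gluing_functor[OF that(1)]
    by (simp add: gluing_functor_def gluing_datum_def)
  have "isomorphism T (k \<cdot>\<^bsub>T\<^esub> h)" "isomorphism T (h \<cdot>\<^bsub>T\<^esub> k)"
    using trivial[OF T.Comp_Hom[OF h k(1)] X] trivial[OF T.Comp_Hom[OF k(1) h] Y]
      \<Phi>.on_Arr_Comp[OF h k(1)] \<Phi>.on_Arr_Comp[OF k(1) h] m k(2) by simp_all
  then show "isomorphism T h" using T.isomorphism_of_composites[OF h k(1)] by simp
qed

lemma epivalence_gluing_functor: "epivalence T gluing_category gluing_functor"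
  unfolding epivalence_def
  using is_functor_gluing_functor full_gluing_functor dense_gluing_functor
    detects_isomorphisms_gluing_functor by simp

end

section \<open>The epivalence attached to a recollement\<close>

theorem theoremA:
  fixes T' :: "('o1, 'm1) tri_cat" and T :: "('o, 'm) tri_cat" and T'' :: "('o2, 'm2) tri_cat"
    and i :: "('o1, 'm1, 'o, 'm) func" and i\<^sub>l i\<^sub>r :: "('o, 'm, 'o1, 'm1) func"
    and j :: "('o, 'm, 'o2, 'm2) func" and j\<^sub>l j\<^sub>r :: "('o2, 'm2, 'o, 'm) func"
  assumes "recollement T' T T'' i i\<^sub>l i\<^sub>r j j\<^sub>l j\<^sub>r"
  shows "\<exists>\<Phi>. epivalence T (comma T'' T' (i\<^sub>r \<circ>\<^sub>F j\<^sub>l)) \<Phi>"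
proof -
  note R = assms[unfolded recollement_def]
  obtain \<psi> \<epsilon>' \<epsilon> \<phi>' \<phi> \<eta> \<eta>' where adj: "adjunction T' T i i\<^sub>r \<epsilon>' \<epsilon>"
    "adjunction T'' T j\<^sub>l j \<phi>' \<phi>" "adjunction T T'' j j\<^sub>r \<eta> \<eta>'"
    and ex: "\<forall>X \<in> Ob T.
        (\<exists>\<delta>. exact_triangle T (on_Ob (i \<circ>\<^sub>F i\<^sub>r) X) X (on_Ob (j\<^sub>r \<circ>\<^sub>F j) X) (\<epsilon> X) (\<eta> X) \<delta>) \<and>
        (\<exists>\<sigma>. exact_triangle T (on_Ob (j\<^sub>l \<circ>\<^sub>F j) X) X (on_Ob (i \<circ>\<^sub>F i\<^sub>l) X) (\<phi> X) (\<psi> X) \<sigma>)"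
    using R by metis
  obtain Z \<tau> where Z: "zero_object T'' Z"
    and "natural_isomorphism T' T'' (j \<circ>\<^sub>F i) (constant_functor T'' Z) \<tau>"
    using R unfolding naturally_isomorphic_def by metis
  then interpret \<tau>: natural_isomorphism T' T'' "j \<circ>\<^sub>F i" "constant_functor T'' Z" \<tau> by simp
  interpret T'': triangulated_category T'' using R by simp
  \<comment> \<open>Each component of \<open>\<tau>\<close> is an isomorphism onto the zero object
    \<open>Z\<close>.\<close>
  have ji: "zero_object T'' (on_Ob j (on_Ob i A))" if "A \<in> Ob T'" for A
    using T''.zero_object_isomorphic[OF Z \<tau>.component_iso[OF that]] \<tau>.component[OF that]
    by (simp add: constant_functor_def)
  have "recollement_functors T' T T'' i i\<^sub>r j j\<^sub>l j\<^sub>r \<epsilon>' \<epsilon> \<phi>' \<phi> \<eta> \<eta>'"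
    using R adj ex ji
    by (intro recollement_functors.intro recollement_functors_axioms.intro)
      (simp_all add: triangle_functor_additive)
  then interpret recollement_functors T' T T'' i i\<^sub>r j j\<^sub>l j\<^sub>r \<epsilon>' \<epsilon> \<phi>' \<phi> \<eta> \<eta>' .
  show ?thesis using epivalence_gluing_functor by blast
qed

end
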